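(* Let $n,d,m\ge 1$, let $a_1,\dots,a_m\in\mathbb{R}[x]_d$, $b=(b_1,\dots,b_m)\in\mathbb{R}^m$, $d_1=2\lceil d/2\rceil$, and let $K=\{x\in\mathbb{R}^n: c_i(x)=0\ (i\in\mathcal{E}),\ c_j(x)\ge 0\ (j\in\mathcal{I})\}$, where $\mathcal{E},\mathcal{I}$ are disjoint finite label sets and all $c_i,c_j\in\mathbb{R}[x]$. Let $R$ be a generic polynomial in $\Sigma[x]_{d_1}$. Consider the moment optimization problem $$(P)\qquad \min\ \langle R,y\rangle\quad\text{s.t.}\quad \langle a_i,y\rangle=b_i\ (i=1,\dots,m),\quad y\in\mathscr{R}_{d_1}(K),$$ and its dual $$(D)\qquad \max\ b^T\lambda\quad\text{s.t.}\quad R-\sum_{i=1}^m\lambda_i a_i\in\mathscr{P}_{d_1}(K),\quad \lambda\in\mathbb{R}^m.$$ Suppose $K$ is compact and $(P)$ is feasible. Then: (i) The optimal values of $(P)$ and $(D)$ are equal, and the optimal value of $(P)$ is achievable (attained). (ii) If $R$ is generic in $\Sigma[x]_{d_1}$, then $(P)$ has a unique minimizer $y^*$, and $y^*$ admits a $K$-representing measure $\mu$ that is $r$-atomic with $r\le m$.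
   Context: $\mathbb{R}[x]=\mathbb{R}[x_1,\dots,x_n]$; $\mathbb{R}[x]_d$ is the set of polynomials of degree at most $d$; $\mathbb{N}^n_d=\{\alpha\in\mathbb{N}^n:|\alpha|=\alpha_1+\cdots+\alpha_n\le d\}$. $\Sigma[x]$ is the cone of sums of squares of polynomials in $\mathbb{R}[x]$, and $\Sigma[x]_d=\Sigma[x]\cap\mathbb{R}[x]_d$. A truncated multi-sequence (tms) of degree $d$ is a real vector $y=(y_\alpha)_{\alpha\in\mathbb{N}^n_d}\in\mathbb{R}^{\mathbb{N}^n_d}$. For $p=\sum_{\alpha\in\mathbb{N}^n_d}p_\alpha x^\alpha$ set $\langle p,y\rangle=\sum_{\alpha\in\mathbb{N}^n_d}p_\alpha y_\alpha$. $\mathscr{B}(K)$ is the set of (nonnegative) Borel measures on $\mathbb{R}^n$ supported in $K$. The moment cone is $$\mathscr{R}_{d_1}(K)=\Big\{y\in\mathbb{R}^{\mathbb{N}^n_{d_1}}:\ \exists\,\mu\in\mathscr{B}(K)\text{ with } y_\alpha=\int x^\alpha\,d\mu\ \ \forall\alpha\in\mathbb{N}^n_{d_1}\Big\};$$ such a $\mu$ is called a $K$-representing measure for $y$. The measure $\mu$ is $r$-atomic if its support consists of $r$ distinct points. $\mathscr{P}_{d_1}(K)=\{f\in\mathbb{R}[x]_{d_1}: f(x)\ge 0\ \forall x\in K\}$. "Generic in $\Sigma[x]_{d_1}$" means: the assertion holds for all $R\in\Sigma[x]_{d_1}$ outside a subset of Lebesgue measure zero in the vector space $\mathbb{R}[x]_{d_1}$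 (for the given data $K,a_i,b$). *)

theory Defs
  imports "HOL-Analysis.Analysis" "HOL-Library.Poly_Mapping"
begin

text \<open>
  Exponents are vectors in \<open>nat ^ 'n\<close>, and a polynomial in the variables indexed by \<open>'n\<close> is its
  finitely supported coefficient function. Ring operations on this type are those of
  \<open>Poly_Mapping\<close>: multiplication is convolution over exponent addition.
\<close>
type_synonym 'n rpoly = "(nat, 'n) vec \<Rightarrow>\<^sub>0 real"

definition monom_eval :: "nat ^ 'n \<Rightarrow> real ^ 'n \<Rightarrow> real" where
  "monom_eval \<alpha> x = (\<Prod>i\<in>UNIV. (x $ i) ^ (\<alpha> $ i))"

definition poly_eval :: "'n::finite rpoly \<Rightarrow> real ^ 'n \<Rightarrow> real" where
  "poly_eval p x = (\<Sum>\<alpha>\<in>Poly_Mapping.keys p. Poly_Mapping.lookup p \<alpha> * monom_eval \<alpha> x)"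

definition exponents_le :: "nat \<Rightarrow> (nat ^ 'n) set" where
  "exponents_le d = {\<alpha>. (\<Sum>i\<in>UNIV. \<alpha> $ i) \<le> d}"

definition polys_le :: "nat \<Rightarrow> 'n::finite rpoly set" where
  "polys_le d = {p. Poly_Mapping.keys p \<subseteq> exponents_le d}"

definition sos_polys :: "'n::finite rpoly set" where
  "sos_polys = {p. \<exists>(k::nat) q. p = (\<Sum>i<k. (q i)\<^sup>2)}"

definition sos_polys_le :: "nat \<Rightarrow> 'n::finite rpoly set" where
  "sos_polys_le d = sos_polys \<inter> polys_le d"

definition nonneg_polys :: "nat \<Rightarrow> (real ^ 'n) set \<Rightarrow> 'n::finite rpoly set" where
  "nonneg_polys d K = {f \<in> polys_le d. \<forall>x\<in>K. poly_eval f x \<ge> 0}"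

text \<open>
  A tms of degree \<open>d\<close> is represented by a function on all exponents that is extensional on
  \<open>exponents_le d\<close> (that is, \<open>undefined\<close> elsewhere), so that equality of functions is equality
  of truncated multi-sequences.
\<close>
definition tms :: "nat \<Rightarrow> (nat ^ 'n \<Rightarrow> real) set" where
  "tms d = extensional (exponents_le d)"

definition pairing :: "nat \<Rightarrow> 'n::finite rpoly \<Rightarrow> (nat ^ 'n \<Rightarrow> real) \<Rightarrow> real" where
  "pairing d p y = (\<Sum>\<alpha>\<in>exponents_le d. Poly_Mapping.lookup p \<alpha> * y \<alpha>)"

definition measure_support :: "'a::topological_space measure \<Rightarrow> 'a set" where
  "measure_support \<mu> = {x. \<forall>U. open U \<longrightarrow> x \<in> U \<longrightarrow> emeasure \<mu> U > 0}"

definition borel_measures_on :: "'a::topological_space set \<Rightarrow> 'a measure set" where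
  "borel_measures_on K = {\<mu>. sets \<mu> = sets borel \<and> measure_support \<mu> \<subseteq> K}"

text \<open>
  \<open>has_bochner_integral\<close> includes integrability of the monomials, which \<open>lebesgue_integral\<close>
  alone would not; for the exponent 0 this makes \<open>\<mu>\<close> a finite measure.
\<close>
definition representing_measure ::
    "nat \<Rightarrow> (real ^ 'n) set \<Rightarrow> (nat ^ 'n \<Rightarrow> real) \<Rightarrow> (real ^ 'n) measure \<Rightarrow> bool" where
  "representing_measure d K y \<mu> \<longleftrightarrow> \<mu> \<in> borel_measures_on K \<and>
     (\<forall>\<alpha>\<in>exponents_le d. has_bochner_integral \<mu> (monom_eval \<alpha>) (y \<alpha>))"

definition moment_cone :: "nat \<Rightarrow> (real ^ 'n) set \<Rightarrow> (nat ^ 'n \<Rightarrow> real) set" where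
  "moment_cone d K = {y \<in> tms d. \<exists>\<mu>. representing_measure d K y \<mu>}"

definition atomic_measure :: "nat \<Rightarrow> 'a::topological_space measure \<Rightarrow> bool" where
  "atomic_measure r \<mu> \<longleftrightarrow> finite (measure_support \<mu>) \<and> card (measure_support \<mu>) = r"

definition semialgebraic_set ::
    "'l set \<Rightarrow> 'l set \<Rightarrow> ('l \<Rightarrow> 'n::finite rpoly) \<Rightarrow> (real ^ 'n) set" where
  "semialgebraic_set E I c =
     {x. (\<forall>i\<in>E. poly_eval (c i) x = 0) \<and> (\<forall>j\<in>I. poly_eval (c j) x \<ge> 0)}"

text \<open>
  Lebesgue null sets of the space of polynomials of degree at most \<open>d\<close>, which is identified with
  a coordinate space by taking coefficients. Passing to the completion allows arbitrary
  Lebesgue-measurable (not only Borel) null sets.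
\<close>
definition poly_null_set :: "nat \<Rightarrow> 'n::finite rpoly set \<Rightarrow> bool" where
  "poly_null_set d N \<longleftrightarrow> N \<subseteq> polys_le d \<and>
     (\<lambda>p. restrict (Poly_Mapping.lookup p) (exponents_le d)) ` N
       \<in> null_sets (completion (Pi\<^sub>M (exponents_le d) (\<lambda>_. lborel)))"

definition generic_sos :: "nat \<Rightarrow> ('n::finite rpoly \<Rightarrow> bool) \<Rightarrow> bool" where
  "generic_sos d P \<longleftrightarrow> (\<exists>N. poly_null_set d N \<and> (\<forall>R \<in> sos_polys_le d - N. P R))"

definition primal_feasible ::
    "nat \<Rightarrow> (real ^ 'n) set \<Rightarrow> ('m \<Rightarrow> 'n::finite rpoly) \<Rightarrow> real ^ 'm \<Rightarrow> (nat ^ 'n \<Rightarrow> real) set" where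
  "primal_feasible d K a b = {y \<in> moment_cone d K. \<forall>i. pairing d (a i) y = b $ i}"

text \<open>\<open>Poly_Mapping.map ((*) t) p\<close> is the scalar multiple of \<open>p\<close> by \<open>t\<close>.\<close>
definition dual_feasible ::
    "nat \<Rightarrow> (real ^ 'n) set \<Rightarrow> ('m::finite \<Rightarrow> 'n::finite rpoly) \<Rightarrow> 'n rpoly \<Rightarrow> (real ^ 'm) set" where
  "dual_feasible d K a R =
     {l. R - (\<Sum>i\<in>UNIV. Poly_Mapping.map ((*) (l $ i)) (a i)) \<in> nonneg_polys d K}"

text \<open>Optimal values are extended reals, so that they exist without boundedness or feasibility.\<close>
definition primal_value ::
    "nat \<Rightarrow> (real ^ 'n) set \<Rightarrow> ('m \<Rightarrow> 'n::finite rpoly) \<Rightarrow> real ^ 'm \<Rightarrow> 'n rpoly \<Rightarrow> ereal" where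
  "primal_value d K a b R = (INF y \<in> primal_feasible d K a b. ereal (pairing d R y))"

definition dual_value ::
    "nat \<Rightarrow> (real ^ 'n) set \<Rightarrow> ('m::finite \<Rightarrow> 'n::finite rpoly) \<Rightarrow> real ^ 'm \<Rightarrow> 'n rpoly \<Rightarrow> ereal" where
  "dual_value d K a b R = (SUP l \<in> dual_feasible d K a R. ereal (b \<bullet> l))"

definition primal_minimizer ::
    "nat \<Rightarrow> (real ^ 'n) set \<Rightarrow> ('m \<Rightarrow> 'n::finite rpoly) \<Rightarrow> real ^ 'm \<Rightarrow> 'n rpoly
      \<Rightarrow> (nat ^ 'n \<Rightarrow> real) \<Rightarrow> bool" where
  "primal_minimizer d K a b R y \<longleftrightarrow>
     is_arg_min (pairing d R) (\<lambda>z. z \<in> primal_feasible d K a b) y"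

end

theory Submission imports Defs begin

text \<open>
  For compact \<open>K\<close> the moment cone consists of the conic combinations of the moment vectors of points
  of \<open>K\<close>: this cone has compact sections, hence is closed, and a vector outside it is separated from
  it by a polynomial that is nonnegative on \<open>K\<close>. If \<open>R > 0\<close> on \<open>K\<close>, the sublevel sets of the
  objective are therefore compact, so the minimum is attained; the same separation argument for the
  vectors \<open>(R(x), a\<^sub>1(x), \<dots>, a\<^sub>m(x))\<close> gives strong duality.

  The exceptional sets are null by Fubini, because they meet every line in a coordinate direction
  at most once. A sum of squares that vanishes somewhere on \<open>K\<close> has infimum zero, which happens at most once
  on a line in the direction of the constant polynomial. If there are two minimizers, they lie on
  different sides of a rational strip \<open>p < y\<^sub>\<alpha> < q\<close>, and for fixed \<open>p\<close>, \<open>q\<close> this happens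
  at most once on a line in direction \<open>\<alpha>\<close>.

  If the unique minimizer had more than \<open>m\<close> atoms, then some perturbation of the weights would
  preserve the \<open>m\<close> constraints; by uniqueness it preserves the whole moment vector, so an atom can
  be removed.
\<close>

section \<open>Conic combinations\<close>

text \<open>Gaussian elimination, one coordinate per induction step: a vector \<open>s0\<close> with
  nonzero coordinate \<open>j\<close> serves as pivot, clears \<open>j\<close> from the other
  vectors, and is removed together with \<open>j\<close>.\<close>

lemma exists_linear_dependence:
  fixes v :: "'a \<Rightarrow> 'i \<Rightarrow> real"
  assumes "finite I" "finite S" "card I < card S"
  shows "\<exists>c. (\<exists>s\<in>S. c s \<noteq> 0) \<and> (\<forall>i\<in>I. (\<Sum>s\<in>S. c s * v s i) = 0)"
  using assms
proof (induction I arbitrary: S v rule: finite_induct)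
  case empty
  then have "S \<noteq> {}" by auto
  then show ?case by (auto intro!: exI[of _ "\<lambda>_. 1"])
next
  case (insert j I)
  show ?case
  proof (cases "\<forall>s\<in>S. v s j = 0")
    case True
    have "card I < card S" using insert by simp
    from insert.IH[OF insert.prems(1) this, of v] True show ?thesis by auto
  next
    case False
    then obtain s0 where s0: "s0 \<in> S" "v s0 j \<noteq> 0" by auto
    define u where "u s i = v s i - v s j / v s0 j * v s0 i" for s i
    have "card I < card (S - {s0})" using insert s0 by simp
    from insert.IH[OF _ this, of u] insert.prems(1)
    obtain c where c: "\<exists>s\<in>S - {s0}. c s \<noteq> 0" "\<forall>i\<in>I. (\<Sum>s\<in>S - {s0}. c s * u s i) = 0" by auto
    \<comment> \<open>The coefficient at the pivot absorbs the corrections built into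
      \<open>u\<close>, so \<open>c'\<close> has the same sums over \<open>v\<close> as
      \<open>c\<close> over \<open>u\<close>; in coordinate \<open>j\<close> these vanish term by
      term.\<close>
    define c' where "c' = c(s0 := - (\<Sum>s\<in>S - {s0}. c s * v s j) / v s0 j)"
    have split: "(\<Sum>s\<in>S. c' s * v s i) = (\<Sum>s\<in>S - {s0}. c s * u s i)" for i
    proof -
      have "(\<Sum>s\<in>S. c' s * v s i) = c' s0 * v s0 i + (\<Sum>s\<in>S - {s0}. c' s * v s i)"
        using insert.prems(1) s0(1) by (simp add: sum.remove)
      also have "(\<Sum>s\<in>S - {s0}. c' s * v s i) = (\<Sum>s\<in>S - {s0}. c s * v s i)"
        by (rule sum.cong) (auto simp: c'_def)
      also have "c' s0 * v s0 i = - (\<Sum>s\<in>S - {s0}. c s * (v s j / v s0 j * v s0 i))"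
        by (simp add: c'_def sum_distrib_right sum_divide_distrib mult.assoc)
      finally show ?thesis
        by (simp add: u_def right_diff_distrib sum_subtractf)
    qed
    have "(\<Sum>s\<in>S - {s0}. c s * u s j) = 0"
      by (rule sum.neutral) (use s0 in \<open>auto simp: u_def\<close>)
    with c have "\<forall>i\<in>insert j I. (\<Sum>s\<in>S. c' s * v s i) = 0" by (auto simp: split)
    moreover have "\<exists>s\<in>S. c' s \<noteq> 0" using c(1) by (auto simp: c'_def)
    ultimately show ?thesis by blast
  qed
qed


text \<open>The weights move along \<open>- c\<close> until the first of them reaches zero.
  Quantifying over all \<open>g\<close> annihilated by \<open>c\<close> lets one reduced set serve
  every coordinate at once.\<close>

lemma drop_dependent_atom_pos:
  fixes w c :: "'a \<Rightarrow> real"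
  assumes S: "finite S" and w: "\<forall>s\<in>S. 0 < w s" and c: "s1 \<in> S" "0 < c s1"
  shows "\<exists>S' w'. S' \<subset> S \<and> (\<forall>s\<in>S'. 0 < w' s) \<and>
           (\<forall>g. (\<Sum>s\<in>S. c s * g s) = 0 \<longrightarrow> (\<Sum>s\<in>S'. w' s * g s) = (\<Sum>s\<in>S. w s * g s))"
proof -
  define P where "P = {s \<in> S. 0 < c s}"
  have P: "finite P" "P \<noteq> {}" using S c by (auto simp: P_def)
  define s0 where "s0 = arg_min_on (\<lambda>s. w s / c s) P"
  have s0: "s0 \<in> P" using arg_min_if_finite(1)[OF P] by (simp add: s0_def)
  have le: "w s0 / c s0 \<le> w s / c s" if "s \<in> P" for s
    using arg_min_least[OF P that, of "\<lambda>s. w s / c s"] by (simp add: s0_def)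
  \<comment> \<open>The minimal ratio over the atoms with positive \<open>c\<close> is the largest
    step that keeps all weights nonnegative; the weight of \<open>s0\<close> then becomes
    zero.\<close>
  define t where "t = w s0 / c s0"
  define w' where "w' s = w s - t * c s" for s
  define S' where "S' = {s \<in> S. w' s \<noteq> 0}"
  have t: "0 < t" using s0 w by (auto simp: t_def P_def)
  have w': "0 \<le> w' s" if "s \<in> S" for s
  proof (cases "0 < c s")
    case True
    then have "t \<le> w s / c s" using le that by (simp add: t_def P_def)
    with True show ?thesis by (simp add: w'_def field_simps)
  next
    case False
    then have "t * c s \<le> 0" using t by (simp add: mult_le_0_iff)
    then show ?thesis using w that by (force simp: w'_def)
  qed
  have "w' s0 = 0" using s0 by (auto simp: w'_def t_def P_def)
  then have "S' \<subset> S" using s0 by (auto simp: S'_def P_def)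
  moreover have "\<forall>s\<in>S'. 0 < w' s" using w' by (force simp: S'_def)
  moreover have "(\<Sum>s\<in>S'. w' s * g s) = (\<Sum>s\<in>S. w s * g s)"
    if "(\<Sum>s\<in>S. c s * g s) = 0" for g
  proof -
    have "(\<Sum>s\<in>S'. w' s * g s) = (\<Sum>s\<in>S. w' s * g s)"
      by (rule sum.mono_neutral_left) (use S in \<open>auto simp: S'_def\<close>)
    also have "\<dots> = (\<Sum>s\<in>S. w s * g s) - t * (\<Sum>s\<in>S. c s * g s)"
      by (simp add: w'_def left_diff_distrib sum_subtractf sum_distrib_left mult.assoc)
    finally show ?thesis using that by simp
  qed
  ultimately show ?thesis by blast
qed

lemma drop_dependent_atom:
  fixes w c :: "'a \<Rightarrow> real"
  assumes S: "finite S" and w: "\<forall>s\<in>S. 0 < w s" and c: "\<exists>s\<in>S. c s \<noteq> 0"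
  shows "\<exists>S' w'. S' \<subset> S \<and> (\<forall>s\<in>S'. 0 < w' s) \<and>
           (\<forall>g. (\<Sum>s\<in>S. c s * g s) = 0 \<longrightarrow> (\<Sum>s\<in>S'. w' s * g s) = (\<Sum>s\<in>S. w s * g s))"
proof -
  from c obtain s1 where s1: "s1 \<in> S" "0 < c s1 \<or> 0 < - c s1" by force
  from s1(2) show ?thesis
  proof
    assume "0 < c s1"
    from drop_dependent_atom_pos[OF S w s1(1), where c = c, OF this] show ?thesis .
  next
    assume "0 < - c s1"
    from drop_dependent_atom_pos[OF S w s1(1), where c = "\<lambda>s. - c s", OF this]
    show ?thesis by (simp add: sum_negf)
  qed
qed

lemma caratheodory_atoms:
  fixes v :: "'a \<Rightarrow> 'i \<Rightarrow> real"
  assumes "finite I" "finite S" "\<forall>s\<in>S. 0 < w s"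
  shows "\<exists>S' w'. S' \<subseteq> S \<and> card S' \<le> card I \<and> (\<forall>s\<in>S'. 0 < w' s) \<and>
           (\<forall>i\<in>I. (\<Sum>s\<in>S'. w' s * v s i) = (\<Sum>s\<in>S. w s * v s i))"
  using assms(2,3)
proof (induction S arbitrary: w rule: finite_psubset_induct)
  case (psubset S)
  show ?case
  proof (cases "card S \<le> card I")
    case True
    with psubset.prems show ?thesis by blast
  next
    case False
    then obtain c where c: "\<exists>s\<in>S. c s \<noteq> 0" "\<forall>i\<in>I. (\<Sum>s\<in>S. c s * v s i) = 0"
      using exists_linear_dependence[OF assms(1) psubset.hyps(1), of v] by auto
    from drop_dependent_atom[OF psubset.hyps(1) psubset.prems c(1)]
    obtain T u where T: "T \<subset> S" "\<forall>s\<in>T. 0 < u s"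
      "\<forall>g. (\<Sum>s\<in>S. c s * g s) = 0 \<longrightarrow> (\<Sum>s\<in>T. u s * g s) = (\<Sum>s\<in>S. w s * g s)"
      by (elim exE conjE)
    from psubset.IH[OF T(1,2)] obtain S' w' where
      "S' \<subseteq> T" "card S' \<le> card I" "\<forall>s\<in>S'. 0 < w' s"
      "\<forall>i\<in>I. (\<Sum>s\<in>S'. w' s * v s i) = (\<Sum>s\<in>T. u s * v s i)" by (elim exE conjE)
    with T c(2) show ?thesis by (intro exI[of _ S'] exI[of _ w']) auto
  qed
qed

section \<open>Cones of finite combinations: closure properties and compact sections\<close>

text \<open>The family \<open>v\<close> is left general: it is used both for moment vectors and for
  the vectors of values of \<open>R\<close> and the \<open>a i\<close>. Strict positivity makes
  \<open>S\<close> the exact support of the associated atomic measure, and restriction to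
  \<open>I\<close> matches the encoding of a tms.\<close>

definition conic_combs :: "'i set \<Rightarrow> 'a set \<Rightarrow> ('a \<Rightarrow> 'i \<Rightarrow> real) \<Rightarrow> ('i \<Rightarrow> real) set" where
  "conic_combs I K v =
     {\<lambda>i\<in>I. \<Sum>x\<in>S. w x * v x i | S w. finite S \<and> S \<subseteq> K \<and> (\<forall>x\<in>S. 0 < w x)}"

lemma conic_combs_extensional: "conic_combs I K v \<subseteq> extensional I"
  by (auto simp: conic_combs_def)

lemma conic_combsE:
  assumes "y \<in> conic_combs I K v"
  obtains S w where "finite S" "S \<subseteq> K" "\<forall>x\<in>S. 0 < w x"
    "y = (\<lambda>i\<in>I. \<Sum>x\<in>S. w x * v x i)"
  using assms unfolding conic_combs_def by blast

text \<open>This introduction rule tolerates repeated nodes and zero weights: indices of weight zero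
  are discarded and the weights of equal nodes are merged.\<close>

lemma conic_combs_indexed:
  assumes J: "finite J" and x: "\<And>j. j \<in> J \<Longrightarrow> x j \<in> K" and w: "\<And>j. j \<in> J \<Longrightarrow> 0 \<le> w j"
  shows "(\<lambda>i\<in>I. \<Sum>j\<in>J. w j * v (x j) i) \<in> conic_combs I K v"
proof -
  define J' where "J' = {j \<in> J. 0 < w j}"
  define u where "u s = (\<Sum>j\<in>{j \<in> J'. x j = s}. w j)" for s
  have J': "finite J'" using J by (simp add: J'_def)
  have eq: "(\<Sum>j\<in>J. w j * v (x j) i) = (\<Sum>s\<in>x ` J'. u s * v s i)" for i
  proof -
    have "(\<Sum>j\<in>J. w j * v (x j) i) = (\<Sum>j\<in>J'. w j * v (x j) i)"
      by (rule sum.mono_neutral_right) (use J w in \<open>force simp: J'_def\<close>)+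
    also have "\<dots> = (\<Sum>s\<in>x ` J'. \<Sum>j\<in>{j \<in> J'. x j = s}. w j * v (x j) i)"
      by (rule sum.image_gen[OF J'])
    also have "\<dots> = (\<Sum>s\<in>x ` J'. u s * v s i)"
      by (rule sum.cong) (auto simp: u_def sum_distrib_right)
    finally show ?thesis .
  qed
  have "0 < u s" if "s \<in> x ` J'" for s
    unfolding u_def by (rule sum_pos) (use that J in \<open>auto simp: J'_def\<close>)
  moreover have "x ` J' \<subseteq> K" using x by (auto simp: J'_def)
  ultimately show ?thesis using J' unfolding conic_combs_def eq by blast
qed

text \<open>The two sets of nodes are joined as a disjoint sum, so that common nodes need no
  separate treatment.\<close>

lemma conic_combs_add:
  fixes v :: "'a \<Rightarrow> 'i \<Rightarrow> real"
  assumes "y \<in> conic_combs I K v" "z \<in> conic_combs I K v" "0 \<le> s" "0 \<le> t"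
  shows "(\<lambda>i\<in>I. s * y i + t * z i) \<in> conic_combs I K v"
proof -
  obtain S w where S: "finite S" "S \<subseteq> K" "\<forall>x\<in>S. 0 < w x"
    "y = (\<lambda>i\<in>I. \<Sum>x\<in>S. w x * v x i)" using assms(1) by (rule conic_combsE)
  obtain T u where T: "finite T" "T \<subseteq> K" "\<forall>x\<in>T. 0 < u x"
    "z = (\<lambda>i\<in>I. \<Sum>x\<in>T. u x * v x i)" using assms(2) by (rule conic_combsE)
  define x where "x j = (case j of Inl a \<Rightarrow> a | Inr a \<Rightarrow> a)" for j :: "'a + 'a"
  define c where "c j = (case j of Inl a \<Rightarrow> s * w a | Inr a \<Rightarrow> t * u a)" for j :: "'a + 'a"
  have "(\<lambda>i\<in>I. \<Sum>j\<in>S <+> T. c j * v (x j) i) \<in> conic_combs I K v"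
  proof (rule conic_combs_indexed)
    show "0 \<le> c j" if "j \<in> S <+> T" for j
      using that S(3) T(3) assms(3,4) by (fastforce simp: c_def)
  qed (use S T in \<open>auto simp: x_def\<close>)
  also have "(\<lambda>i\<in>I. \<Sum>j\<in>S <+> T. c j * v (x j) i) = (\<lambda>i\<in>I. s * y i + t * z i)"
    by (rule restrict_ext)
      (simp add: sum.Plus S T x_def c_def sum_distrib_left mult.assoc)
  finally show ?thesis .
qed

lemma conic_combs_zero: "(\<lambda>i\<in>I. 0) \<in> conic_combs I K v"
  using conic_combs_indexed[of "{}" "\<lambda>_. undefined" K "\<lambda>_. 0" v I] by simp

lemma conic_combs_atom: "x \<in> K \<Longrightarrow> restrict (v x) I \<in> conic_combs I K v"
  using conic_combs_indexed[of "{x}" "\<lambda>x. x" K "\<lambda>_. 1" v I] by simp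

lemma sum_conic_comb:
  fixes p :: "'i \<Rightarrow> real"
  shows "(\<Sum>i\<in>I. p i * (\<lambda>i\<in>I. \<Sum>x\<in>S. w x * v x i) i) = (\<Sum>x\<in>S. w x * (\<Sum>i\<in>I. p i * v x i))"
proof -
  have "(\<Sum>i\<in>I. p i * (\<lambda>i\<in>I. \<Sum>x\<in>S. w x * v x i) i) = (\<Sum>i\<in>I. \<Sum>x\<in>S. p i * (w x * v x i))"
    by (simp add: sum_distrib_left)
  also have "\<dots> = (\<Sum>x\<in>S. \<Sum>i\<in>I. p i * (w x * v x i))" by (rule sum.swap)
  also have "\<dots> = (\<Sum>x\<in>S. w x * (\<Sum>i\<in>I. p i * v x i))"
    by (simp add: sum_distrib_left mult.left_commute)
  finally show ?thesis .
qed

text \<open>By Caratheodory's theorem a bounded part of the cone is a continuous image of a compact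
  space of nodes and weights.\<close>
lemma compact_conic_combs_section:
  fixes v :: "'a::topological_space \<Rightarrow> 'i \<Rightarrow> real"
  assumes I: "finite I" "i0 \<in> I" and K: "compact K"
    and v: "\<And>i. i \<in> I \<Longrightarrow> continuous_on K (\<lambda>x. v x i)"
    and e: "0 < e" "\<And>x. x \<in> K \<Longrightarrow> e \<le> v x i0"
  shows "compact {y \<in> conic_combs I K v. y i0 \<le> M}"
proof (cases "K = {}")
  case True
  then have "conic_combs I K v = {\<lambda>i\<in>I. 0}" by (auto simp: conic_combs_def)
  then have "finite {y \<in> conic_combs I K v. y i0 \<le> M}" by simp
  then show ?thesis by (rule finite_imp_compact)
next
  case False
  then obtain x0 where x0: "x0 \<in> K" by auto
  \<comment> \<open>Caratheodory leaves at most \<open>card I\<close> nodes; the lower bound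
    \<open>e\<close> and the bound \<open>M\<close> on coordinate \<open>i0\<close> confine each
    weight to the interval from 0 to \<open>M / e\<close>.\<close>
  define J where "J = {..<card I}"
  define P where "P = PiE J (\<lambda>_. K \<times> {0..M / e})"
  define F where "F q = (\<lambda>i\<in>I. \<Sum>j\<in>J. snd (q j) * v (fst (q j)) i)" for q :: "nat \<Rightarrow> 'a \<times> real"
  have J: "finite J" by (simp add: J_def)
  let ?X = "product_topology (\<lambda>_. top_of_set (K \<times> {0..M / e})) J"
  have top: "topspace ?X = P" by (simp add: P_def)
  have X: "compact_space ?X"
    using K by (auto simp: compact_space_product_topology compact_space_subtopology compact_Times)
  have "continuous_map ?X euclidean (\<lambda>q. F q i)" for i
  proof (cases "i \<in> I")
    case True
    have "continuous_on (K \<times> {0..M / e}) (\<lambda>z. snd z * v (fst z) i)"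
      by (intro continuous_intros continuous_on_compose2[OF v[OF True]]) auto
    then have g: "continuous_map (top_of_set (K \<times> {0..M / e})) euclideanreal (\<lambda>z. snd z * v (fst z) i)"
      by simp
    have "continuous_map ?X euclideanreal (\<lambda>q. snd (q j) * v (fst (q j)) i)" if "j \<in> J" for j
      using continuous_map_compose[OF continuous_map_product_projection[OF that] g]
      by (simp add: o_def)
    then show ?thesis using True J by (auto simp: F_def intro!: continuous_map_sum)
  qed (simp add: F_def)
  then have "continuous_map ?X (product_topology (\<lambda>_. euclidean) UNIV) F"
    by (simp add: continuous_map_componentwise_UNIV)
  then have cont: "continuous_map ?X euclidean F" by (simp add: euclidean_product_topology)
  have "compactin euclidean (F ` P)"
    using image_compactin[OF _ cont, of P] X top by (simp add: compact_space_def)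
  then have cF: "compact (F ` P)" by simp
  have "{y \<in> conic_combs I K v. y i0 \<le> M} = F ` P \<inter> {y. y i0 \<le> M}"
  proof safe
    fix y assume y: "y \<in> conic_combs I K v" and M: "y i0 \<le> M"
    from y obtain S w where S: "finite S" "S \<subseteq> K" "\<forall>x\<in>S. 0 < w x"
      "y = (\<lambda>i\<in>I. \<Sum>x\<in>S. w x * v x i)" by (rule conic_combsE)
    obtain T u where T: "T \<subseteq> S" "card T \<le> card I" "\<forall>s\<in>T. 0 < u s"
      "\<forall>i\<in>I. (\<Sum>s\<in>T. u s * v s i) = (\<Sum>s\<in>S. w s * v s i)"
      using caratheodory_atoms[OF I(1) S(1), of w v] S(3) by auto
    have fT: "finite T" using T(1) S(1) by (rule finite_subset)
    have TK: "T \<subseteq> K" using T(1) S(2) by auto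
    have M0: "(\<Sum>s\<in>T. u s * v s i0) \<le> M" using M T(4) I(2) by (simp add: S(4))
    have ub: "u s \<le> M / e" if s: "s \<in> T" for s
    proof -
      have "u s * e \<le> u s * v s i0" using T(3) s e(2) TK by (intro mult_left_mono) force+
      also have "\<dots> \<le> (\<Sum>s\<in>T. u s * v s i0)"
      proof (rule member_le_sum[OF s _ fT])
        fix x assume "x \<in> T - {s}"
        then show "0 \<le> u x * v x i0"
          using T(3) e(1) e(2)[of x] TK by (intro mult_nonneg_nonneg) force+
      qed
      finally show ?thesis using M0 e(1) by (simp add: pos_le_divide_eq)
    qed
    have "0 \<le> (\<Sum>s\<in>T. u s * v s i0)"
    proof (intro sum_nonneg mult_nonneg_nonneg)
      fix x assume "x \<in> T"
      then show "0 \<le> u x" "0 \<le> v x i0" using T(3) e(1) e(2)[of x] TK by force+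
    qed
    with M0 have "0 \<le> M" by linarith
    then have M0': "0 \<le> M / e" using e(1) by simp
    obtain h where h: "bij_betw h {..<card T} T"
      using ex_bij_betw_nat_finite[OF fT] by (auto simp: lessThan_atLeast0)
    \<comment> \<open>Slots beyond \<open>card T\<close> are padded with the node \<open>x0\<close>
      and weight zero.\<close>
    define q where "q = (\<lambda>j\<in>J. if j < card T then (h j, u (h j)) else (x0, 0))"
    have "h j \<in> T" if "j < card T" for j using h that by (auto simp: bij_betw_def)
    then have "q \<in> P"
      using T(3) TK ub x0 M0' by (force simp: P_def q_def intro!: PiE_I)
    moreover have "y = F q"
    proof -
      have "(\<Sum>j\<in>J. snd (q j) * v (fst (q j)) i) = (\<Sum>s\<in>T. u s * v s i)" for i
      proof -
        have "(\<Sum>j\<in>J. snd (q j) * v (fst (q j)) i) = (\<Sum>j<card T. u (h j) * v (h j) i)"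
          by (rule sum.mono_neutral_cong_right) (use T(2) in \<open>auto simp: J_def q_def\<close>)
        also have "\<dots> = (\<Sum>s\<in>T. u s * v s i)"
          by (rule sum.reindex_bij_betw[OF h])
        finally show ?thesis .
      qed
      then show ?thesis using T(4) by (auto simp: F_def S(4))
    qed
    ultimately show "y \<in> F ` P" by blast
  next
    fix q assume q: "q \<in> P"
    show "F q \<in> conic_combs I K v"
      unfolding F_def by (rule conic_combs_indexed[OF J]) (use q in \<open>auto simp: P_def PiE_iff mem_Times_iff\<close>)
  qed
  moreover have "closed {y :: 'i \<Rightarrow> real. y i0 \<le> M}"
    by (intro closed_Collect_le continuous_intros continuous_on_product_coordinates)
  ultimately show ?thesis using cF by (simp add: compact_Int_closed)
qed

section \<open>Minimization over the cone and separation from it\<close>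

lemma conic_combs_pairing_mono:
  fixes p q :: "'i \<Rightarrow> real"
  assumes y: "y \<in> conic_combs I K v"
    and le: "\<And>x. x \<in> K \<Longrightarrow> (\<Sum>i\<in>I. p i * v x i) \<le> (\<Sum>i\<in>I. q i * v x i)"
  shows "(\<Sum>i\<in>I. p i * y i) \<le> (\<Sum>i\<in>I. q i * y i)"
proof -
  obtain S w where S: "finite S" "S \<subseteq> K" "\<forall>x\<in>S. 0 < w x"
    "y = (\<lambda>i\<in>I. \<Sum>x\<in>S. w x * v x i)" using y by (rule conic_combsE)
  show ?thesis unfolding S(4) sum_conic_comb
    by (intro sum_mono mult_left_mono le) (use S in \<open>auto intro: less_imp_le\<close>)
qed

text \<open>The functional dominates \<open>\<delta>\<close> times coordinate \<open>i0\<close> on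
  the cone, so every point outside a suitable section has a value at least that of a fixed feasible
  point \<open>y0\<close>. Inside the section, compactness gives a minimum.\<close>

lemma conic_combs_attains_min:
  fixes v :: "'a::topological_space \<Rightarrow> 'i \<Rightarrow> real"
  assumes I: "finite I" "i0 \<in> I" and K: "compact K"
    and v: "\<And>i. i \<in> I \<Longrightarrow> continuous_on K (\<lambda>x. v x i)"
    and e: "0 < e" "\<And>x. x \<in> K \<Longrightarrow> e \<le> v x i0"
    and f: "0 < \<delta>" "\<And>x. x \<in> K \<Longrightarrow> \<delta> * v x i0 \<le> (\<Sum>i\<in>I. f i * v x i)"
    and H: "closed H" "conic_combs I K v \<inter> H \<noteq> {}"
  shows "\<exists>y\<in>conic_combs I K v \<inter> H. \<forall>z\<in>conic_combs I K v \<inter> H. (\<Sum>i\<in>I. f i * y i) \<le> (\<Sum>i\<in>I. f i * z i)"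
proof -
  let ?C = "conic_combs I K v"
  let ?L = "\<lambda>y. \<Sum>i\<in>I. f i * y i"
  have lower: "\<delta> * y i0 \<le> ?L y" if "y \<in> ?C" for y
  proof -
    have eq: "(\<Sum>i\<in>I. (if i = i0 then \<delta> else 0) * u i) = \<delta> * u i0" for u
      using I by (simp add: if_distrib[of "\<lambda>x. x * _"] cong: if_cong)
    have "(\<Sum>i\<in>I. (if i = i0 then \<delta> else 0) * y i) \<le> ?L y"
      by (rule conic_combs_pairing_mono[OF that]) (simp only: eq f(2))
    then show ?thesis by (simp only: eq)
  qed
  obtain y0 where y0: "y0 \<in> ?C" "y0 \<in> H" using H(2) by auto
  define M where "M = ?L y0 / \<delta>"
  define T where "T = {y \<in> ?C. y i0 \<le> M} \<inter> H"
  have "compact T"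
    unfolding T_def by (intro compact_Int_closed compact_conic_combs_section[where v = v, OF I K v e] H)
  moreover have "y0 \<in> T"
    using y0 lower[of y0] f(1) by (simp add: T_def M_def pos_le_divide_eq mult.commute)
  moreover have "continuous_on T ?L"
    by (intro continuous_intros continuous_on_subset[OF continuous_on_product_coordinates]) auto
  ultimately obtain y where y: "y \<in> T" "\<And>z. z \<in> T \<Longrightarrow> ?L y \<le> ?L z"
    using continuous_attains_inf[of T ?L] by blast
  have "?L y \<le> ?L z" if z: "z \<in> ?C \<inter> H" for z
  proof (cases "z i0 \<le> M")
    case True
    then show ?thesis using z by (intro y(2)) (auto simp: T_def)
  next
    case False
    have "?L y \<le> ?L y0" using y(2) \<open>y0 \<in> T\<close> by blast
    also have "\<dots> = \<delta> * M" using f(1) by (simp add: M_def)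
    also have "\<dots> \<le> \<delta> * z i0" using False f(1) by simp
    also have "\<dots> \<le> ?L z" using lower z by blast
    finally show ?thesis .
  qed
  then show ?thesis using y(1) unfolding T_def by blast
qed

text \<open>For small \<open>t\<close> the linear term dominates. This turns minimality of a squared
  distance along a segment into a first-order condition.\<close>

lemma nonneg_of_quadratic_near_0:
  fixes a b :: real
  assumes "\<And>t. 0 < t \<Longrightarrow> t < 1 \<Longrightarrow> 0 \<le> 2 * t * a + t\<^sup>2 * b"
  shows "0 \<le> a"
proof (rule ccontr)
  assume a: "\<not> 0 \<le> a"
  \<comment> \<open>\<open>B\<close> exceeds \<open>- a\<close>, which gives \<open>t < 1\<close>,
    and exceeds \<open>b\<close>, which gives \<open>t * b \<le> - a\<close>; hence
    \<open>2 * a + t * b\<close> is at most \<open>a\<close>, a negative number.\<close>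
  define B where "B = \<bar>b\<bar> + \<bar>a\<bar> + 1"
  define t where "t = - a / B"
  have B: "0 < B" "b < B" "- a < B" by (auto simp: B_def)
  have t: "0 < t" "t < 1" using a B by (auto simp: t_def field_simps)
  have "t * b \<le> t * B" using t B by simp
  also have "\<dots> = - a" using B by (simp add: t_def)
  finally have "2 * a + t * b < 0" using a by linarith
  then have "t * (2 * a + t * b) < 0" using t by (simp add: mult_pos_neg)
  with assms[OF t] show False by (simp add: algebra_simps power2_eq_square)
qed

text \<open>The separating functional is the difference between \<open>y\<close> and its nearest point in the cone.\<close>
lemma conic_combs_separation:
  fixes v :: "'a::topological_space \<Rightarrow> 'i \<Rightarrow> real"
  assumes I: "finite I" "i0 \<in> I" and K: "compact K"
    and v: "\<And>i. i \<in> I \<Longrightarrow> continuous_on K (\<lambda>x. v x i)"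
    and e: "0 < e" "\<And>x. x \<in> K \<Longrightarrow> e \<le> v x i0"
    and y: "y \<in> extensional I" "y \<notin> conic_combs I K v"
  obtains p where "(\<Sum>i\<in>I. p i * y i) < 0" "\<And>x. x \<in> K \<Longrightarrow> 0 \<le> (\<Sum>i\<in>I. p i * v x i)"
proof -
  let ?C = "conic_combs I K v"
  define N where "N z = (\<Sum>i\<in>I. (z i - y i)\<^sup>2)" for z
  define o' where "o' = (\<lambda>i\<in>I. 0 :: real)"
  have o': "o' \<in> ?C" unfolding o'_def by (rule conic_combs_zero)
  have N0: "0 \<le> N z" for z by (simp add: N_def sum_nonneg)
  \<comment> \<open>Beyond this bound coordinate \<open>i0\<close> alone contributes at least the
    square of \<open>1 + N o'\<close> to the squared distance, so such points are no nearer to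
    \<open>y\<close> than the origin \<open>o'\<close>, and the nearest point of the section is
    nearest in the whole cone.\<close>
  define M where "M = \<bar>y i0\<bar> + 1 + N o'"
  define T where "T = {z \<in> ?C. z i0 \<le> M}"
  have "compact T" unfolding T_def by (rule compact_conic_combs_section[where v = v, OF I K v e])
  moreover have "o' \<in> T" using o' I N0[of o'] by (simp add: T_def M_def) (simp add: o'_def)
  moreover have "continuous_on T N"
    unfolding N_def
    by (intro continuous_intros continuous_on_subset[OF continuous_on_product_coordinates]) auto
  ultimately obtain z where z: "z \<in> T" "\<And>u. u \<in> T \<Longrightarrow> N z \<le> N u"
    using continuous_attains_inf[of T N] by blast
  have min: "N z \<le> N u" if u: "u \<in> ?C" for u
  proof (cases "u i0 \<le> M")
    case True
    then show ?thesis using u by (intro z(2)) (auto simp: T_def)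
  next
    case False
    have "N z \<le> N o'" using z(2) \<open>o' \<in> T\<close> by blast
    also have "\<dots> \<le> (1 + N o')\<^sup>2" using N0[of o'] by (simp add: power2_sum)
    also have "\<dots> \<le> (u i0 - y i0)\<^sup>2"
      using False N0[of o'] by (intro power_mono) (auto simp: M_def)
    also have "\<dots> \<le> N u"
      unfolding N_def by (rule member_le_sum) (use I in auto)
    finally show ?thesis .
  qed
  define p where "p i = z i - y i" for i
  have zC: "z \<in> ?C" using z(1) by (simp add: T_def)
  have expand: "N (\<lambda>i\<in>I. z i + t * u i) = N z + 2 * t * (\<Sum>i\<in>I. p i * u i) + t\<^sup>2 * (\<Sum>i\<in>I. (u i)\<^sup>2)" for t u
  proof -
    have "N (\<lambda>i\<in>I. z i + t * u i) = (\<Sum>i\<in>I. (z i - y i)\<^sup>2 + 2 * t * (p i * u i) + t\<^sup>2 * (u i)\<^sup>2)"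
      unfolding N_def by (rule sum.cong) (auto simp: p_def power2_eq_square algebra_simps)
    then show ?thesis by (simp add: sum.distrib sum_distrib_left N_def)
  qed
  have pos: "0 \<le> (\<Sum>i\<in>I. p i * u i)" if u: "u \<in> ?C" for u
  proof (rule nonneg_of_quadratic_near_0)
    fix t :: real assume t: "0 < t" "t < 1"
    have "(\<lambda>i\<in>I. 1 * z i + t * u i) \<in> ?C" using zC u t by (intro conic_combs_add) auto
    from min[OF this] show "0 \<le> 2 * t * (\<Sum>i\<in>I. p i * u i) + t\<^sup>2 * (\<Sum>i\<in>I. (u i)\<^sup>2)"
      using expand[of t u] by simp
  qed
  \<comment> \<open>Shrinking \<open>z\<close> towards the origin stays in the cone, so the
    first-order condition holds in direction \<open>- z\<close> too.\<close>
  have neg: "0 \<le> - (\<Sum>i\<in>I. p i * z i)"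
  proof (rule nonneg_of_quadratic_near_0)
    fix t :: real assume t: "0 < t" "t < 1"
    have "(\<lambda>i\<in>I. (1 - t) * z i + 0 * z i) \<in> ?C" using zC t by (intro conic_combs_add) auto
    also have "(\<lambda>i\<in>I. (1 - t) * z i + 0 * z i) = (\<lambda>i\<in>I. z i + (- t) * z i)"
      by (auto simp: algebra_simps)
    finally have "(\<lambda>i\<in>I. z i + (- t) * z i) \<in> ?C" .
    from min[OF this] show "0 \<le> 2 * t * - (\<Sum>i\<in>I. p i * z i) + t\<^sup>2 * (\<Sum>i\<in>I. (z i)\<^sup>2)"
      unfolding expand by simp
  qed
  have "\<exists>i\<in>I. p i \<noteq> 0"
  proof (rule ccontr)
    assume "\<not> ?thesis"
    then have "z = y"
      using y(1) zC conic_combs_extensional[of I K v] by (intro extensionalityI[of z I y]) (auto simp: p_def)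
    with y(2) zC show False by simp
  qed
  then have "0 < (\<Sum>i\<in>I. (p i)\<^sup>2)" using I(1) by (auto intro: sum_pos2)
  \<comment> \<open>Since \<open>y\<close> is \<open>z - p\<close>, the pairing with
    \<open>y\<close> is a nonpositive number minus the squared norm of \<open>p\<close>.\<close>
  moreover have "(\<Sum>i\<in>I. p i * y i) = (\<Sum>i\<in>I. p i * z i) - (\<Sum>i\<in>I. (p i)\<^sup>2)"
    unfolding sum_subtractf[symmetric] by (rule sum.cong) (auto simp: p_def power2_eq_square algebra_simps)
  ultimately have "(\<Sum>i\<in>I. p i * y i) < 0" using neg by linarith
  moreover have "0 \<le> (\<Sum>i\<in>I. p i * v x i)" if "x \<in> K" for x
    using pos[OF conic_combs_atom[OF that, of v I]] by simp
  ultimately show thesis by (rule that)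
qed

section \<open>Null sets, atomic measures and polynomial evaluation\<close>

text \<open>By Fubini, integrating first over coordinate \<open>i\<close>: each slice has at most
  one point, hence length zero.\<close>

lemma null_sets_PiM_lborel_line:
  fixes A :: "('i \<Rightarrow> real) set"
  assumes I: "finite I" "i \<in> I" and A: "A \<in> sets (Pi\<^sub>M I (\<lambda>_. lborel))"
    and line: "\<And>f s t. f(i := s) \<in> A \<Longrightarrow> f(i := t) \<in> A \<Longrightarrow> s = t"
  shows "A \<in> null_sets (Pi\<^sub>M I (\<lambda>_. lborel))"
proof -
  interpret product_sigma_finite "\<lambda>_ :: 'i. lborel :: real measure"
    by (simp add: product_sigma_finite_def lborel.sigma_finite_measure_axioms)
  have slice: "(\<integral>\<^sup>+ t. indicator A (f(i := t)) \<partial>lborel) = 0" for f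
  proof -
    define T where "T = {t. f(i := t) \<in> A}"
    have "T = {} \<or> (\<exists>t. T = {t})" using line unfolding T_def by blast
    then have "T \<in> sets lborel \<and> emeasure lborel T = 0" by auto
    moreover have "(\<lambda>t. indicator A (f(i := t)) :: ennreal) = indicator T"
      by (auto simp: T_def indicator_def fun_eq_iff)
    ultimately show ?thesis by simp
  qed
  have "emeasure (Pi\<^sub>M I (\<lambda>_. lborel)) A = (\<integral>\<^sup>+ f. indicator A f \<partial>Pi\<^sub>M I (\<lambda>_. lborel))"
    using A by simp
  also have "\<dots> = (\<integral>\<^sup>+ f. indicator A f \<partial>Pi\<^sub>M (insert i (I - {i})) (\<lambda>_. lborel))"
    using I by (simp add: insert_absorb)
  also have "\<dots> = (\<integral>\<^sup>+ f. (\<integral>\<^sup>+ t. indicator A (f(i := t)) \<partial>lborel) \<partial>Pi\<^sub>M (I - {i}) (\<lambda>_. lborel))"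
    using I A by (intro product_nn_integral_insert) (auto simp: insert_absorb)
  also have "\<dots> = 0" by (simp add: slice)
  finally show ?thesis using A by (simp add: null_setsI)
qed

text \<open>\<open>G\<close> may be uncountable, but the functional is continuous in
  \<open>y\<close>, so a countable dense subset has the same infimum. Countability of the index type
  supplies such a subset.\<close>

lemma borel_measurable_INF_linear:
  fixes G :: "('i::countable \<Rightarrow> real) set"
  assumes I: "finite I"
  shows "(\<lambda>f. INF y\<in>G. ereal (\<Sum>i\<in>I. f i * y i)) \<in> borel_measurable (Pi\<^sub>M I (\<lambda>_. lborel))"
proof -
  obtain D where D: "countable D" "D \<subseteq> G" "G \<subseteq> closure D" using separable[of G] by blast
  have "(INF y\<in>G. ereal (\<Sum>i\<in>I. f i * y i)) = (INF y\<in>D. ereal (\<Sum>i\<in>I. f i * y i))" for f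
  proof (rule antisym)
    show "(INF y\<in>G. ereal (\<Sum>i\<in>I. f i * y i)) \<le> (INF y\<in>D. ereal (\<Sum>i\<in>I. f i * y i))"
      by (rule INF_superset_mono[OF D(2)]) simp
    show "(INF y\<in>D. ereal (\<Sum>i\<in>I. f i * y i)) \<le> (INF y\<in>G. ereal (\<Sum>i\<in>I. f i * y i))"
    proof (rule INF_greatest)
      fix y assume "y \<in> G"
      then obtain u where u: "\<And>n. u n \<in> D" "u \<longlonglongrightarrow> y"
        using D(3) closure_sequential[of y D] by blast
      have "(\<lambda>n. u n i) \<longlonglongrightarrow> y i" for i
        using continuous_on_tendsto_compose[OF continuous_on_product_coordinates u(2)] by simp
      then have "(\<lambda>n. ereal (\<Sum>i\<in>I. f i * u n i)) \<longlonglongrightarrow> ereal (\<Sum>i\<in>I. f i * y i)"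
        by (intro tendsto_intros)
      then show "(INF y\<in>D. ereal (\<Sum>i\<in>I. f i * y i)) \<le> ereal (\<Sum>i\<in>I. f i * y i)"
        by (rule LIMSEQ_le_const) (use u(1) in \<open>auto intro!: INF_lower\<close>)
    qed
  qed
  moreover have "(\<lambda>f. INF y\<in>D. ereal (\<Sum>i\<in>I. f i * y i)) \<in> borel_measurable (Pi\<^sub>M I (\<lambda>_. lborel))"
  proof (rule borel_measurable_INF[OF D(1)])
    fix y assume "y \<in> D"
    have "(\<lambda>f. f i) \<in> borel_measurable (Pi\<^sub>M I (\<lambda>_. lborel :: real measure))" if "i \<in> I" for i
      using measurable_component_singleton[OF that, of "\<lambda>_. lborel :: real measure"] by simp
    then show "(\<lambda>f. ereal (\<Sum>i\<in>I. f i * y i)) \<in> borel_measurable (Pi\<^sub>M I (\<lambda>_. lborel))"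
      by (intro borel_measurable_ereal borel_measurable_sum borel_measurable_times) auto
  qed
  ultimately show ?thesis by presburger
qed

section \<open>Support of a measure and atomic measures\<close>

text \<open>The complement of the support is a union of open null sets, and by Lindelof countably
  many of them suffice.\<close>

lemma AE_measure_support:
  fixes \<mu> :: "'a::second_countable_topology measure"
  assumes \<mu>: "sets \<mu> = sets borel"
  shows "AE x in \<mu>. x \<in> measure_support \<mu>"
proof -
  define \<F> where "\<F> = {U. open U \<and> emeasure \<mu> U = 0}"
  obtain \<G> where \<G>: "\<G> \<subseteq> \<F>" "countable \<G>" "\<Union>\<G> = \<Union>\<F>"
    using Lindelof_openin[of \<F> UNIV] by (auto simp: \<F>_def)
  have "\<Union>\<G> \<in> null_sets \<mu>"
  proof -
    have "U \<in> null_sets \<mu>" if "U \<in> \<G>" for U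
      using that \<G>(1) \<mu> by (auto simp: \<F>_def null_sets_def)
    then show ?thesis using null_sets_UN'[OF \<G>(2), of "\<lambda>U. U" \<mu>] by simp
  qed
  moreover have "{x \<in> space \<mu>. x \<notin> measure_support \<mu>} \<subseteq> \<Union>\<G>"
    unfolding \<G>(3) by (auto simp: measure_support_def \<F>_def)
  ultimately show ?thesis by (rule AE_I')
qed

lemma ex_atomic_measure:
  fixes S :: "'a::t1_space set"
  assumes S: "finite S" and w: "\<forall>x\<in>S. 0 < w x"
  shows "\<exists>\<mu>. sets \<mu> = sets borel \<and> measure_support \<mu> = S \<and>
    (\<forall>g :: 'a \<Rightarrow> real. g \<in> borel_measurable borel \<longrightarrow> has_bochner_integral \<mu> g (\<Sum>x\<in>S. w x * g x))"
proof -
  \<comment> \<open>The point measure lives on the power set of \<open>S\<close>; its image under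
    the identity is a Borel measure on the whole space.\<close>
  define \<nu> where "\<nu> = point_measure S (\<lambda>x. ennreal (w x))"
  define \<mu> where "\<mu> = distr \<nu> borel (\<lambda>x. x)"
  have meas: "(\<lambda>x. x) \<in> measurable \<nu> borel" by (simp add: \<nu>_def)
  have em: "emeasure \<mu> U = (\<Sum>x\<in>U \<inter> S. ennreal (w x))" if "open U" for U
    using that S by (simp add: \<mu>_def emeasure_distr[OF meas])
      (simp add: \<nu>_def space_point_measure emeasure_point_measure_finite)
  have "measure_support \<mu> = S"
  proof safe
    fix x assume x: "x \<in> measure_support \<mu>"
    show "x \<in> S"
    proof (rule ccontr)
      assume "x \<notin> S"
      moreover have "open (- S)" using S by (simp add: finite_imp_closed open_Compl)
      ultimately have "0 < emeasure \<mu> (- S)" using x by (auto simp: measure_support_def)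
      with em[OF \<open>open (- S)\<close>] show False by simp
    qed
  next
    fix x assume x: "x \<in> S"
    show "x \<in> measure_support \<mu>"
      unfolding measure_support_def
    proof safe
      fix U :: "'a set" assume U: "open U" "x \<in> U"
      have "0 < ennreal (w x)" using w x by simp
      also have "\<dots> \<le> (\<Sum>x\<in>U \<inter> S. ennreal (w x))"
        by (rule member_le_sum) (use x U S in auto)
      finally show "0 < emeasure \<mu> U" using em[OF U(1)] by simp
    qed
  qed
  moreover have "has_bochner_integral \<mu> g (\<Sum>x\<in>S. w x * g x)"
    if g: "g \<in> borel_measurable borel" for g :: "'a \<Rightarrow> real"
  proof -
    have "integrable \<nu> g"
      unfolding \<nu>_def point_measure_def
      using S w by (subst integrable_density) (auto simp: AE_count_space integrable_count_space less_imp_le)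
    moreover have "integral\<^sup>L \<nu> g = (\<Sum>x\<in>S. w x * g x)"
      unfolding \<nu>_def using S w by (subst lebesgue_integral_point_measure_finite) (auto intro: less_imp_le)
    ultimately show ?thesis
      unfolding \<mu>_def using has_bochner_integral_distr[OF g meas] by (simp add: has_bochner_integral_iff)
  qed
  moreover have "sets \<mu> = sets borel" by (simp add: \<mu>_def)
  ultimately show ?thesis by blast
qed

section \<open>Monomials and polynomial evaluation\<close>

lemma finite_exponents_le: "finite (exponents_le d :: (nat ^ 'n) set)"
proof (rule finite_subset)
  show "(exponents_le d :: (nat ^ 'n) set) \<subseteq> vec_lambda ` (PiE UNIV (\<lambda>_. {..d}))"
  proof
    fix \<alpha> :: "nat ^ 'n" assume "\<alpha> \<in> exponents_le d"
    then have "(\<Sum>i\<in>UNIV. \<alpha> $ i) \<le> d" by (simp add: exponents_le_def)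
    then have "\<alpha> $ i \<le> d" for i
      using member_le_sum[of i UNIV "\<lambda>i. \<alpha> $ i"] by (simp add: order_trans)
    then show "\<alpha> \<in> vec_lambda ` (PiE UNIV (\<lambda>_. {..d}))"
      by (intro image_eqI[of _ _ "\<lambda>i. \<alpha> $ i"]) auto
  qed
qed (simp add: finite_PiE)

lemma zero_in_exponents_le: "0 \<in> exponents_le d"
  by (simp add: exponents_le_def)

lemma monom_eval_zero [simp]: "monom_eval 0 x = 1"
  by (simp add: monom_eval_def)

lemma monom_eval_add: "monom_eval (\<alpha> + \<beta>) x = monom_eval \<alpha> x * monom_eval \<beta> x"
  by (simp add: monom_eval_def power_add prod.distrib)

lemma continuous_on_monom_eval: "continuous_on S (monom_eval \<alpha>)"
  unfolding monom_eval_def by (intro continuous_intros)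

lemma poly_eval_superset:
  assumes "finite A" "Poly_Mapping.keys p \<subseteq> A"
  shows "poly_eval p x = (\<Sum>\<alpha>\<in>A. Poly_Mapping.lookup p \<alpha> * monom_eval \<alpha> x)"
  unfolding poly_eval_def
  by (rule sum.mono_neutral_left) (use assms in \<open>auto simp: in_keys_iff\<close>)

lemma poly_eval_polys_le:
  assumes "p \<in> polys_le d"
  shows "poly_eval p x = (\<Sum>\<alpha>\<in>exponents_le d. Poly_Mapping.lookup p \<alpha> * monom_eval \<alpha> x)"
  using assms by (intro poly_eval_superset finite_exponents_le) (auto simp: polys_le_def)

lemma poly_eval_zero [simp]: "poly_eval 0 x = 0"
  by (simp add: poly_eval_def)

lemma poly_eval_add: "poly_eval (p + q) x = poly_eval p x + poly_eval q x"
proof -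
  let ?A = "Poly_Mapping.keys p \<union> Poly_Mapping.keys q"
  have "poly_eval (p + q) x = (\<Sum>\<alpha>\<in>?A. Poly_Mapping.lookup (p + q) \<alpha> * monom_eval \<alpha> x)"
    by (rule poly_eval_superset) (use Poly_Mapping.keys_add[of p q] in auto)
  also have "\<dots> = (\<Sum>\<alpha>\<in>?A. Poly_Mapping.lookup p \<alpha> * monom_eval \<alpha> x) + (\<Sum>\<alpha>\<in>?A. Poly_Mapping.lookup q \<alpha> * monom_eval \<alpha> x)"
    by (simp add: lookup_add distrib_right sum.distrib)
  also have "\<dots> = poly_eval p x + poly_eval q x"
    using poly_eval_superset[of ?A p x] poly_eval_superset[of ?A q x] by simp
  finally show ?thesis .
qed

lemma poly_eval_sum: "poly_eval (sum p A) x = (\<Sum>i\<in>A. poly_eval (p i) x)"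
  by (induction A rule: infinite_finite_induct) (auto simp: poly_eval_add)

lemma poly_eval_single: "poly_eval (Poly_Mapping.single \<alpha> c) x = c * monom_eval \<alpha> x"
  using poly_eval_superset[of "{\<alpha>}" "Poly_Mapping.single \<alpha> c" x] by auto

lemma poly_mapping_sum_single:
  "p = (\<Sum>\<alpha>\<in>Poly_Mapping.keys p. Poly_Mapping.single \<alpha> (Poly_Mapping.lookup p \<alpha>))"
proof (rule poly_mapping_eqI)
  fix \<beta>
  have "(\<Sum>\<alpha>\<in>Poly_Mapping.keys p. Poly_Mapping.lookup (Poly_Mapping.single \<alpha> (Poly_Mapping.lookup p \<alpha>)) \<beta>)
      = (\<Sum>\<alpha>\<in>Poly_Mapping.keys p. if \<alpha> = \<beta> then Poly_Mapping.lookup p \<beta> else 0)"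
    by (rule sum.cong) (auto simp: lookup_single when_def)
  also have "\<dots> = Poly_Mapping.lookup p \<beta>" by (auto simp: in_keys_iff)
  finally show "Poly_Mapping.lookup p \<beta> = Poly_Mapping.lookup
      (\<Sum>\<alpha>\<in>Poly_Mapping.keys p. Poly_Mapping.single \<alpha> (Poly_Mapping.lookup p \<alpha>)) \<beta>"
    by (simp add: lookup_sum)
qed

lemma poly_eval_mult: "poly_eval (p * q) x = poly_eval p x * poly_eval q x"
proof -
  let ?P = "Poly_Mapping.keys p" and ?Q = "Poly_Mapping.keys q"
  let ?p = "Poly_Mapping.lookup p" and ?q = "Poly_Mapping.lookup q"
  have "p * q = (\<Sum>\<alpha>\<in>?P. Poly_Mapping.single \<alpha> (?p \<alpha>)) * (\<Sum>\<beta>\<in>?Q. Poly_Mapping.single \<beta> (?q \<beta>))"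
    by (rule arg_cong2[where f = "(*)", OF poly_mapping_sum_single poly_mapping_sum_single])
  also have "\<dots> = (\<Sum>\<alpha>\<in>?P. \<Sum>\<beta>\<in>?Q. Poly_Mapping.single (\<alpha> + \<beta>) (?p \<alpha> * ?q \<beta>))"
    by (simp add: sum_product mult_single)
  finally have "poly_eval (p * q) x = (\<Sum>\<alpha>\<in>?P. \<Sum>\<beta>\<in>?Q. (?p \<alpha> * ?q \<beta>) * monom_eval (\<alpha> + \<beta>) x)"
    by (simp add: poly_eval_sum poly_eval_single)
  also have "\<dots> = poly_eval p x * poly_eval q x"
    unfolding poly_eval_def sum_product by (intro sum.cong refl) (simp add: monom_eval_add mult.left_commute mult.assoc)
  finally show ?thesis .
qed

lemma poly_eval_sos_nonneg: "p \<in> sos_polys \<Longrightarrow> 0 \<le> poly_eval p x"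
  by (auto simp: sos_polys_def poly_eval_sum power2_eq_square poly_eval_mult intro!: sum_nonneg)

section \<open>The moment cone and duality\<close>

lemma sum_UNIV_option:
  fixes f :: "'m::finite option \<Rightarrow> real"
  shows "(\<Sum>j\<in>UNIV. f j) = f None + (\<Sum>i\<in>UNIV. f (Some i))"
  by (simp add: UNIV_option_conv sum.reindex)

lemma pairing_atoms:
  assumes "p \<in> polys_le d"
  shows "pairing d p (\<lambda>\<alpha>\<in>exponents_le d. \<Sum>x\<in>S. w x * monom_eval \<alpha> x) = (\<Sum>x\<in>S. w x * poly_eval p x)"
  unfolding pairing_def sum_conic_comb[where v = "\<lambda>x \<alpha>. monom_eval \<alpha> x"]
  using poly_eval_polys_le[OF assms] by simp

lemma representing_measure_atoms:
  assumes S: "finite S" "S \<subseteq> K" "\<forall>x\<in>S. 0 < w x"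
  shows "\<exists>\<mu>. representing_measure d K (\<lambda>\<alpha>\<in>exponents_le d. \<Sum>x\<in>S. w x * monom_eval \<alpha> x) \<mu> \<and>
           atomic_measure (card S) \<mu>"
proof -
  obtain \<mu> where \<mu>: "sets \<mu> = sets borel" "measure_support \<mu> = S"
    "\<forall>g :: (real, 'a) vec \<Rightarrow> real. g \<in> borel_measurable borel \<longrightarrow> has_bochner_integral \<mu> g (\<Sum>x\<in>S. w x * g x)"
    using ex_atomic_measure[OF S(1,3)] by blast
  have "monom_eval \<alpha> \<in> borel_measurable borel" for \<alpha> :: "(nat, 'a) vec"
    by (rule borel_measurable_continuous_onI[OF continuous_on_monom_eval])
  then have "representing_measure d K (\<lambda>\<alpha>\<in>exponents_le d. \<Sum>x\<in>S. w x * monom_eval \<alpha> x) \<mu>"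
    using \<mu> S(2) by (simp add: representing_measure_def borel_measures_on_def)
  moreover have "atomic_measure (card S) \<mu>" using \<mu>(2) S(1) by (simp add: atomic_measure_def)
  ultimately show ?thesis by blast
qed

text \<open>A moment vector outside the cone would be separated from it by a polynomial nonnegative
  on \<open>K\<close>. A representing measure is concentrated on its support, inside
  \<open>K\<close>, so the integral of that polynomial cannot be negative. The constant monomial is
  the coordinate bounded below that the separation requires.\<close>

lemma moment_cone_eq_conic_combs:
  fixes K :: "(real ^ 'n) set"
  assumes K: "compact K"
  shows "moment_cone d K = conic_combs (exponents_le d) K (\<lambda>x \<alpha>. monom_eval \<alpha> x)"
proof (intro subset_antisym subsetI)
  fix y assume "y \<in> conic_combs (exponents_le d) K (\<lambda>x \<alpha>. monom_eval \<alpha> x)"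
  then obtain S w where S: "finite S" "S \<subseteq> K" "\<forall>x\<in>S. 0 < w x"
    "y = (\<lambda>\<alpha>\<in>exponents_le d. \<Sum>x\<in>S. w x * monom_eval \<alpha> x)" by (rule conic_combsE)
  show "y \<in> moment_cone d K"
    using representing_measure_atoms[OF S(1-3), of d] by (auto simp: moment_cone_def tms_def S(4))
next
  fix y assume "y \<in> moment_cone d K"
  then obtain \<mu> where y: "y \<in> extensional (exponents_le d)" and \<mu>: "representing_measure d K y \<mu>"
    by (auto simp: moment_cone_def tms_def)
  show "y \<in> conic_combs (exponents_le d) K (\<lambda>x \<alpha>. monom_eval \<alpha> x)"
  proof (rule ccontr)
    assume notin: "y \<notin> conic_combs (exponents_le d) K (\<lambda>x \<alpha>. monom_eval \<alpha> x)"
    obtain p where p: "(\<Sum>\<alpha>\<in>exponents_le d. p \<alpha> * y \<alpha>) < 0"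
      "\<And>x. x \<in> K \<Longrightarrow> 0 \<le> (\<Sum>\<alpha>\<in>exponents_le d. p \<alpha> * monom_eval \<alpha> x)"
      by (rule conic_combs_separation[where e = 1 and v = "\<lambda>x \<alpha>. monom_eval \<alpha> x",
            OF finite_exponents_le zero_in_exponents_le K continuous_on_monom_eval _ _ y notin]) auto
    have int: "has_bochner_integral \<mu> (\<lambda>x. \<Sum>\<alpha>\<in>exponents_le d. p \<alpha> * monom_eval \<alpha> x)
        (\<Sum>\<alpha>\<in>exponents_le d. p \<alpha> * y \<alpha>)"
      using \<mu> by (intro has_bochner_integral_sum has_bochner_integral_mult_right)
        (auto simp: representing_measure_def)
    have "AE x in \<mu>. x \<in> measure_support \<mu>"
      using \<mu> by (intro AE_measure_support) (simp add: representing_measure_def borel_measures_on_def)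
    moreover have "measure_support \<mu> \<subseteq> K"
      using \<mu> by (simp add: representing_measure_def borel_measures_on_def)
    ultimately have "AE x in \<mu>. 0 \<le> (\<Sum>\<alpha>\<in>exponents_le d. p \<alpha> * monom_eval \<alpha> x)"
      by (elim AE_mp) (auto intro!: p(2))
    then have "0 \<le> (\<integral>x. (\<Sum>\<alpha>\<in>exponents_le d. p \<alpha> * monom_eval \<alpha> x) \<partial>\<mu>)"
      by (rule integral_nonneg_AE)
    with p(1) show False using has_bochner_integral_integral_eq[OF int] by simp
  qed
qed

section \<open>Feasible sets, attainment and duality in terms of atoms\<close>

lemma lookup_map_times:
  fixes p :: "'a \<Rightarrow>\<^sub>0 real"
  shows "Poly_Mapping.lookup (Poly_Mapping.map ((*) t) p) \<alpha> = t * Poly_Mapping.lookup p \<alpha>"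
  by (simp add: Poly_Mapping.map.rep_eq when_def)

lemma dual_feasible_iff:
  assumes a: "\<And>i. a i \<in> polys_le d" and R: "R \<in> polys_le d"
  shows "l \<in> dual_feasible d K a R \<longleftrightarrow>
    (\<forall>x\<in>K. (\<Sum>i\<in>UNIV. l $ i * poly_eval (a i) x) \<le> poly_eval R x)"
proof -
  define h where "h = R - (\<Sum>i\<in>UNIV. Poly_Mapping.map ((*) (l $ i)) (a i))"
  have h: "Poly_Mapping.lookup h \<alpha> =
      Poly_Mapping.lookup R \<alpha> - (\<Sum>i\<in>UNIV. l $ i * Poly_Mapping.lookup (a i) \<alpha>)" for \<alpha>
    by (simp add: h_def lookup_minus lookup_sum lookup_map_times)
  have zero: "Poly_Mapping.lookup p \<alpha> = 0" if "p \<in> polys_le d" "\<alpha> \<notin> exponents_le d" for p \<alpha>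
    using that by (auto simp: polys_le_def in_keys_iff)
  have "Poly_Mapping.lookup h \<alpha> = 0" if "\<alpha> \<notin> exponents_le d" for \<alpha>
    using that a R by (simp add: h zero)
  then have hd: "h \<in> polys_le d" by (auto simp: polys_le_def in_keys_iff)
  have "poly_eval h x = poly_eval R x - (\<Sum>i\<in>UNIV. l $ i * poly_eval (a i) x)" for x
  proof -
    have "poly_eval h x = poly_eval R x -
        (\<Sum>\<alpha>\<in>exponents_le d. \<Sum>i\<in>UNIV. l $ i * (Poly_Mapping.lookup (a i) \<alpha> * monom_eval \<alpha> x))"
      by (simp add: poly_eval_polys_le[OF hd] poly_eval_polys_le[OF R] h left_diff_distrib
          sum_subtractf sum_distrib_right mult.assoc)
    also have "(\<Sum>\<alpha>\<in>exponents_le d. \<Sum>i\<in>UNIV. l $ i * (Poly_Mapping.lookup (a i) \<alpha> * monom_eval \<alpha> x)) =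
        (\<Sum>i\<in>UNIV. l $ i * poly_eval (a i) x)"
      by (subst sum.swap) (simp add: poly_eval_polys_le[OF a] sum_distrib_left)
    finally show ?thesis .
  qed
  then show ?thesis using hd by (simp add: dual_feasible_def nonneg_polys_def h_def[symmetric])
qed

lemma primal_feasible_eq:
  assumes "compact K"
  shows "primal_feasible d K a b = conic_combs (exponents_le d) K (\<lambda>x \<alpha>. monom_eval \<alpha> x) \<inter>
    {y. \<forall>i. pairing d (a i) y = b $ i}"
  by (auto simp: primal_feasible_def moment_cone_eq_conic_combs[OF assms])

text \<open>Weights may vanish here because the perturbed weights in the reduction of atoms are only
  known to be nonnegative.\<close>

lemma primal_feasible_atoms_iff:
  assumes "compact K" and a: "\<And>i. a i \<in> polys_le d"
    and "y = (\<lambda>\<alpha>\<in>exponents_le d. \<Sum>x\<in>S. w x * monom_eval \<alpha> x)"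
    and "finite S" "S \<subseteq> K" "\<forall>x\<in>S. 0 \<le> w x"
  shows "y \<in> primal_feasible d K a b \<longleftrightarrow> (\<forall>i. (\<Sum>x\<in>S. w x * poly_eval (a i) x) = b $ i)"
proof -
  have "(\<lambda>\<alpha>\<in>exponents_le d. \<Sum>x\<in>S. w x * monom_eval \<alpha> x)
      \<in> conic_combs (exponents_le d) K (\<lambda>x \<alpha>. monom_eval \<alpha> x)"
    using assms conic_combs_indexed[of S "\<lambda>x. x" K w "\<lambda>x \<alpha>. monom_eval \<alpha> x" "exponents_le d"] by blast
  then show ?thesis
    using assms(1,3) by (simp add: primal_feasible_eq pairing_atoms[OF a])
qed

text \<open>The closed set \<open>H\<close> covers two uses: the whole space for attainment in the
  primal problem, and half-spaces of one coordinate for comparing minimizers.\<close>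

lemma primal_feasible_attains_min:
  fixes H :: "(nat ^ 'n \<Rightarrow> real) set"
  assumes K: "compact K"
    and f: "0 < \<delta>" "\<And>x. x \<in> K \<Longrightarrow> \<delta> \<le> (\<Sum>\<alpha>\<in>exponents_le d. f \<alpha> * monom_eval \<alpha> x)"
    and H: "closed H" "primal_feasible d K a b \<inter> H \<noteq> {}"
  shows "\<exists>y\<in>primal_feasible d K a b \<inter> H. \<forall>z\<in>primal_feasible d K a b \<inter> H.
    (\<Sum>\<alpha>\<in>exponents_le d. f \<alpha> * y \<alpha>) \<le> (\<Sum>\<alpha>\<in>exponents_le d. f \<alpha> * z \<alpha>)"
proof -
  let ?A = "{y. \<forall>i. pairing d (a i) y = b $ i}"
  have "closed ?A"
    unfolding pairing_def
    by (intro closed_Collect_all closed_Collect_eq continuous_intros continuous_on_product_coordinates)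
  then have "closed (?A \<inter> H)" using H(1) by blast
  then show ?thesis
    using conic_combs_attains_min[where v = "\<lambda>x \<alpha>. monom_eval \<alpha> x" and H = "?A \<inter> H" and e = 1 and \<delta> = \<delta> and f = f,
        OF finite_exponents_le[of d] zero_in_exponents_le K continuous_on_monom_eval _ _ f(1)] f(2) H(2)
    unfolding primal_feasible_eq[OF K] Int_assoc by simp
qed

text \<open>The vector of \<open>pairing d R y - \<epsilon>\<close> and \<open>b\<close> lies
  outside the cone generated by the values of \<open>R\<close> and the \<open>a i\<close> on
  \<open>K\<close>. A separating functional, divided by its coefficient at \<open>R\<close>, yields
  the multipliers. Positivity of \<open>R\<close> makes the coordinate \<open>None\<close> bounded
  below, as the separation requires.\<close>

lemma dual_approximation:
  fixes a :: "'m::finite \<Rightarrow> 'n::finite rpoly"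
  assumes K: "compact K" and a: "\<And>i. a i \<in> polys_le d" and R: "R \<in> polys_le d"
    and \<delta>: "0 < \<delta>" "\<And>x. x \<in> K \<Longrightarrow> \<delta> \<le> poly_eval R x"
    and y: "y \<in> primal_feasible d K a b"
    and min: "\<And>z. z \<in> primal_feasible d K a b \<Longrightarrow> pairing d R y \<le> pairing d R z"
    and \<epsilon>: "0 < \<epsilon>"
  shows "\<exists>l\<in>dual_feasible d K a R. pairing d R y - \<epsilon> \<le> b \<bullet> l"
proof -
  define u where "u x j = (case j of None \<Rightarrow> poly_eval R x | Some i \<Rightarrow> poly_eval (a i) x)" for x j
  define t where "t j = (case j of None \<Rightarrow> pairing d R y - \<epsilon> | Some i \<Rightarrow> b $ i)" for j
  have "t \<notin> conic_combs UNIV K u"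
  \<comment> \<open>Membership would produce a feasible \<open>z\<close> whose objective lies
    \<open>\<epsilon>\<close> below the minimum.\<close>
  proof
    assume "t \<in> conic_combs UNIV K u"
    then obtain S w where S: "finite S" "S \<subseteq> K" "\<forall>x\<in>S. 0 < w x"
      "t = (\<lambda>j\<in>UNIV. \<Sum>x\<in>S. w x * u x j)" by (rule conic_combsE)
    define z where "z = (\<lambda>\<alpha>\<in>exponents_le d. \<Sum>x\<in>S. w x * monom_eval \<alpha> x)"
    have "(\<Sum>x\<in>S. w x * poly_eval (a i) x) = b $ i" for i
      using fun_cong[OF S(4), of "Some i"] by (simp add: t_def u_def)
    then have "z \<in> primal_feasible d K a b"
      using S(3) by (subst primal_feasible_atoms_iff[OF K a z_def S(1,2)]) (auto intro: less_imp_le)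
    moreover have "pairing d R z = pairing d R y - \<epsilon>"
      using fun_cong[OF S(4), of None] by (simp add: t_def u_def z_def pairing_atoms[OF R])
    ultimately show False using min[of z] \<epsilon> by simp
  qed
  moreover have "continuous_on K (\<lambda>x. u x j)" for j
    unfolding u_def poly_eval_def by (cases j) (auto intro!: continuous_intros continuous_on_monom_eval)
  moreover have "\<delta> \<le> u x None" if "x \<in> K" for x using \<delta>(2)[OF that] by (simp add: u_def)
  ultimately obtain p where p: "(\<Sum>j\<in>UNIV. p j * t j) < 0" "\<And>x. x \<in> K \<Longrightarrow> 0 \<le> (\<Sum>j\<in>UNIV. p j * u x j)"
    using conic_combs_separation[where I = UNIV and ?i0.0 = None and v = u and e = \<delta> and K = K and y = t] K \<delta>(1)
    by auto
  obtain S w where S: "finite S" "S \<subseteq> K" "\<forall>x\<in>S. 0 < w x"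
    "y = (\<lambda>\<alpha>\<in>exponents_le d. \<Sum>x\<in>S. w x * monom_eval \<alpha> x)"
    using y unfolding primal_feasible_eq[OF K] by (elim IntE conic_combsE)
  have b: "b $ i = (\<Sum>x\<in>S. w x * poly_eval (a i) x)" for i
  proof -
    have "pairing d (a i) y = b $ i" using y by (simp add: primal_feasible_def)
    then show ?thesis unfolding S(4) pairing_atoms[OF a] by simp
  qed
  have neg: "p None * (pairing d R y - \<epsilon>) + (\<Sum>i\<in>UNIV. p (Some i) * b $ i) < 0"
    using p(1) by (simp add: sum_UNIV_option t_def)
  have "p None * pairing d R y + (\<Sum>i\<in>UNIV. p (Some i) * b $ i) = (\<Sum>x\<in>S. w x * (\<Sum>j\<in>UNIV. p j * u x j))"
  proof -
    have "(\<Sum>x\<in>S. w x * (\<Sum>j\<in>UNIV. p j * u x j)) =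
        (\<Sum>j\<in>UNIV. p j * (\<Sum>x\<in>S. w x * u x j))"
      using sum_conic_comb[where I = UNIV and p = p and S = S and w = w and v = u] by simp
    then show ?thesis by (simp add: sum_UNIV_option u_def b S(4) pairing_atoms[OF R])
  qed
  also have "\<dots> \<ge> 0" 
  proof (intro sum_nonneg)
    fix x assume "x \<in> S"
    then show "0 \<le> w x * (\<Sum>j\<in>UNIV. p j * u x j)"
      using S(2,3) p(2)[of x] by (intro mult_nonneg_nonneg) force+
  qed
  \<comment> \<open>The functional is nonnegative at the true vector of \<open>y\<close> and
    negative after lowering its first entry by \<open>\<epsilon>\<close>, so its coefficient there
    is positive.\<close>
  finally have "0 < p None * \<epsilon>" using neg by (simp add: algebra_simps)
  then have pN: "0 < p None" using \<epsilon> by (simp add: zero_less_mult_iff)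
  define l where "l = (\<chi> i. - p (Some i) / p None)"
  have eq: "(\<Sum>i\<in>UNIV. l $ i * g i) = - (\<Sum>i\<in>UNIV. p (Some i) * g i) / p None" for g
    by (simp add: l_def sum_negf sum_divide_distrib)
  have "l \<in> dual_feasible d K a R"
  proof (subst dual_feasible_iff[OF a R], intro ballI)
    fix x assume "x \<in> K"
    from p(2)[OF this] show "(\<Sum>i\<in>UNIV. l $ i * poly_eval (a i) x) \<le> poly_eval R x"
      using pN by (simp add: eq sum_UNIV_option u_def field_simps)
  qed
  moreover have "pairing d R y - \<epsilon> \<le> b \<bullet> l"
  proof -
    have "b \<bullet> l = (\<Sum>i\<in>UNIV. l $ i * b $ i)" by (simp add: inner_vec_def mult.commute)
    also have "\<dots> = - (\<Sum>i\<in>UNIV. p (Some i) * b $ i) / p None" by (rule eq)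
    finally have "p None * (b \<bullet> l) = - (\<Sum>i\<in>UNIV. p (Some i) * b $ i)" using pN by simp
    with neg have "p None * (pairing d R y - \<epsilon>) < p None * (b \<bullet> l)" by linarith
    then show ?thesis using pN by simp
  qed
  ultimately show ?thesis by blast
qed

text \<open>The dual inequality holds at each atom of \<open>y\<close>; summing it with the positive
  weights gives the claim.\<close>

lemma weak_duality:
  fixes a :: "'m::finite \<Rightarrow> 'n::finite rpoly"
  assumes K: "compact K" and a: "\<And>i. a i \<in> polys_le d" and R: "R \<in> polys_le d"
    and l: "l \<in> dual_feasible d K a R" and y: "y \<in> primal_feasible d K a b"
  shows "b \<bullet> l \<le> pairing d R y"
proof -
  obtain S w where S: "finite S" "S \<subseteq> K" "\<forall>x\<in>S. 0 < w x"
    "y = (\<lambda>\<alpha>\<in>exponents_le d. \<Sum>x\<in>S. w x * monom_eval \<alpha> x)"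
    using y unfolding primal_feasible_eq[OF K] by (elim IntE conic_combsE)
  have b: "b $ i = (\<Sum>x\<in>S. w x * poly_eval (a i) x)" for i
  proof -
    have "pairing d (a i) y = b $ i" using y by (simp add: primal_feasible_def)
    then show ?thesis unfolding S(4) pairing_atoms[OF a] by simp
  qed
  have "b \<bullet> l = (\<Sum>i\<in>UNIV. \<Sum>x\<in>S. w x * (l $ i * poly_eval (a i) x))"
    by (simp add: inner_vec_def b sum_distrib_left sum_distrib_right algebra_simps)
  also have "\<dots> = (\<Sum>x\<in>S. w x * (\<Sum>i\<in>UNIV. l $ i * poly_eval (a i) x))"
    by (subst sum.swap) (simp add: sum_distrib_left)
  also have "\<dots> \<le> (\<Sum>x\<in>S. w x * poly_eval R x)"
    using S(2,3) l by (intro sum_mono mult_left_mono) (auto simp: dual_feasible_iff[OF a R] intro: less_imp_le)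
  also have "\<dots> = pairing d R y" by (simp add: S(4) pairing_atoms[OF R])
  finally show ?thesis .
qed

lemma strong_duality:
  fixes a :: "'m::finite \<Rightarrow> 'n::finite rpoly"
  assumes K: "compact K" and a: "\<And>i. a i \<in> polys_le d" and R: "R \<in> polys_le d"
    and \<delta>: "0 < \<delta>" "\<And>x. x \<in> K \<Longrightarrow> \<delta> \<le> poly_eval R x"
    and ne: "primal_feasible d K a b \<noteq> {}"
  shows "primal_value d K a b R = dual_value d K a b R"
    and "\<exists>y\<in>primal_feasible d K a b. ereal (pairing d R y) = primal_value d K a b R"
proof -
  have "\<exists>y\<in>primal_feasible d K a b \<inter> UNIV. \<forall>z\<in>primal_feasible d K a b \<inter> UNIV.
      (\<Sum>\<alpha>\<in>exponents_le d. Poly_Mapping.lookup R \<alpha> * y \<alpha>) \<le> (\<Sum>\<alpha>\<in>exponents_le d. Poly_Mapping.lookup R \<alpha> * z \<alpha>)"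
    using \<delta>(2) ne unfolding poly_eval_polys_le[OF R]
    by (intro primal_feasible_attains_min[OF K \<delta>(1)]) auto
  then obtain y where y: "y \<in> primal_feasible d K a b"
    "\<And>z. z \<in> primal_feasible d K a b \<Longrightarrow> pairing d R y \<le> pairing d R z"
    unfolding pairing_def by blast
  have pv: "primal_value d K a b R = ereal (pairing d R y)"
    unfolding primal_value_def by (rule antisym) (auto intro!: INF_lower INF_greatest y)
  have "dual_value d K a b R \<le> ereal (pairing d R y)"
    unfolding dual_value_def by (auto intro!: SUP_least weak_duality[OF K a R _ y(1)])
  moreover have "ereal (pairing d R y) \<le> dual_value d K a b R"
  proof (rule ereal_le_epsilon2)
    fix \<epsilon> :: real assume "0 < \<epsilon>"
    then obtain l where l: "l \<in> dual_feasible d K a R" "pairing d R y - \<epsilon> \<le> b \<bullet> l"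
      using dual_approximation[OF K a R \<delta> y] by blast
    then have "ereal (pairing d R y) \<le> ereal (b \<bullet> l) + ereal \<epsilon>" by simp
    also have "\<dots> \<le> dual_value d K a b R + ereal \<epsilon>"
      unfolding dual_value_def by (intro add_right_mono SUP_upper l(1))
    finally show "ereal (pairing d R y) \<le> dual_value d K a b R + ereal \<epsilon>" .
  qed
  ultimately show "primal_value d K a b R = dual_value d K a b R" by (simp add: pv)
  show "\<exists>y\<in>primal_feasible d K a b. ereal (pairing d R y) = primal_value d K a b R"
    using y(1) pv by auto
qed

section \<open>Few atoms and genericity\<close>

text \<open>Descent on the number of atoms: minimality and uniqueness upgrade a dependence among the
  constraint values at the atoms to one among all moment coordinates, which
  \<open>drop_dependent_atom\<close> can use.\<close>

lemma unique_minimizer_few_atoms: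
  fixes a :: "'m::finite \<Rightarrow> 'n::finite rpoly"
  assumes K: "compact K" and a: "\<And>i. a i \<in> polys_le d" and R: "R \<in> polys_le d"
    and y: "y \<in> primal_feasible d K a b"
    and min: "\<And>z. z \<in> primal_feasible d K a b \<Longrightarrow> pairing d R y \<le> pairing d R z"
    and uniq: "\<And>z. z \<in> primal_feasible d K a b \<Longrightarrow> pairing d R z = pairing d R y \<Longrightarrow> z = y"
  obtains S w where "finite S" "S \<subseteq> K" "\<forall>x\<in>S. 0 < w x"
    "y = (\<lambda>\<alpha>\<in>exponents_le d. \<Sum>x\<in>S. w x * monom_eval \<alpha> x)" "card S \<le> CARD('m)"
proof -
  have reduce: "\<exists>S' w'. finite S' \<and> S' \<subseteq> K \<and> (\<forall>x\<in>S'. 0 < w' x) \<and>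
      y = (\<lambda>\<alpha>\<in>exponents_le d. \<Sum>x\<in>S'. w' x * monom_eval \<alpha> x) \<and> card S' \<le> CARD('m)"
    if "finite S" "S \<subseteq> K" "\<forall>x\<in>S. 0 < w x"
      "y = (\<lambda>\<alpha>\<in>exponents_le d. \<Sum>x\<in>S. w x * monom_eval \<alpha> x)" for S w
    using that
  proof (induction S arbitrary: w rule: finite_psubset_induct)
    case (psubset S)
    note yS = psubset.prems(3)
    show ?case
    proof (cases "card S \<le> CARD('m)")
      case True
      with psubset show ?thesis by blast
    next
      case False
      then obtain c where c: "\<exists>x\<in>S. c x \<noteq> 0" "\<forall>i. (\<Sum>x\<in>S. c x * poly_eval (a i) x) = 0"
        using exists_linear_dependence[of "UNIV :: 'm set" S "\<lambda>x i. poly_eval (a i) x"] psubset.hyps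
        by auto
      have "S \<noteq> {}" using c(1) by blast
      \<comment> \<open>Small enough for the weights to stay nonnegative in both directions
        \<open>c\<close> and \<open>- c\<close>; adding 1 keeps the denominator positive where
        \<open>c\<close> vanishes.\<close>
      define t where "t = Min ((\<lambda>x. w x / (\<bar>c x\<bar> + 1)) ` S)"
      have t: "0 < t"
        unfolding t_def using psubset.hyps psubset.prems(2) \<open>S \<noteq> {}\<close> by (subst Min_gr_iff) auto
      have tc: "\<bar>t * c x\<bar> \<le> w x" if "x \<in> S" for x
      proof -
        have "t \<le> w x / (\<bar>c x\<bar> + 1)"
          unfolding t_def using psubset.hyps that by (intro Min_le) auto
        then have "t * (\<bar>c x\<bar> + 1) \<le> w x" by (simp add: pos_le_divide_eq)
        then show ?thesis using t by (simp add: abs_mult algebra_simps)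
      qed
      define z where "z s = (\<lambda>\<alpha>\<in>exponents_le d. \<Sum>x\<in>S. (w x + s * c x) * monom_eval \<alpha> x)" for s
      have split: "(\<Sum>x\<in>S. (w x + s * c x) * g x) = (\<Sum>x\<in>S. w x * g x) + s * (\<Sum>x\<in>S. c x * g x)" for s g
        by (simp add: distrib_right sum.distrib sum_distrib_left mult.assoc)
      have feas: "z s \<in> primal_feasible d K a b" if s: "s = t \<or> s = - t" for s
      proof (subst primal_feasible_atoms_iff[OF K a z_def psubset.hyps psubset.prems(1)])
        show "\<forall>x\<in>S. 0 \<le> w x + s * c x" using tc s by (force simp: abs_le_iff)
        have "\<forall>i. pairing d (a i) y = b $ i" using y by (simp add: primal_feasible_def)
        then have "\<forall>i. (\<Sum>x\<in>S. w x * poly_eval (a i) x) = b $ i"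
          unfolding yS pairing_atoms[OF a] .
        then show "\<forall>i. (\<Sum>x\<in>S. (w x + s * c x) * poly_eval (a i) x) = b $ i"
          by (simp add: split c(2))
      qed
      have obj: "pairing d R (z s) = pairing d R y + s * (\<Sum>x\<in>S. c x * poly_eval R x)" for s
        unfolding z_def yS pairing_atoms[OF R] by (rule split)
      \<comment> \<open>The objective is affine in the step and cannot decrease either way, so its
        slope is zero.\<close>
      have "t * (\<Sum>x\<in>S. c x * poly_eval R x) = 0"
        using min[OF feas[of t]] min[OF feas[of "- t"]] unfolding obj by simp
      then have "z t = y" using feas[of t] by (intro uniq) (auto simp: obj)
      have zero: "(\<Sum>x\<in>S. c x * monom_eval \<alpha> x) = 0" if "\<alpha> \<in> exponents_le d" for \<alpha>
        using fun_cong[OF \<open>z t = y\<close>, of \<alpha>] that t by (simp add: z_def yS split)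
      from drop_dependent_atom[OF psubset.hyps psubset.prems(2) c(1)]
      obtain S' w' where S': "S' \<subset> S" "\<forall>x\<in>S'. 0 < w' x"
        "\<forall>g. (\<Sum>x\<in>S. c x * g x) = 0 \<longrightarrow> (\<Sum>x\<in>S'. w' x * g x) = (\<Sum>x\<in>S. w x * g x)"
        by (elim exE conjE)
      have "y = (\<lambda>\<alpha>\<in>exponents_le d. \<Sum>x\<in>S'. w' x * monom_eval \<alpha> x)"
        unfolding yS by (rule restrict_ext) (use S'(3) zero in simp)
      then show ?thesis using psubset.IH[OF S'(1) _ S'(2)] S'(1) psubset.prems(1) by blast
    qed
  qed
  obtain S w where S: "finite S" "S \<subseteq> K" "\<forall>x\<in>S. 0 < w x"
    "y = (\<lambda>\<alpha>\<in>exponents_le d. \<Sum>x\<in>S. w x * monom_eval \<alpha> x)"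
    using y unfolding primal_feasible_eq[OF K] by (elim IntE conic_combsE)
  from reduce[OF S] show thesis by (elim exE conjE) (rule that)
qed

section \<open>Exceptional sets of coefficient vectors\<close>

text \<open>As coordinate \<open>i\<close> equals 1 on \<open>G\<close>, raising the coefficient
  \<open>f i\<close> raises the infimum by at least the same amount, so it is zero at most once on
  each line.\<close>

lemma null_sets_infimum_zero:
  fixes G :: "('i::countable \<Rightarrow> real) set"
  assumes I: "finite I" "i \<in> I" and G: "\<And>y. y \<in> G \<Longrightarrow> y i = 1"
  shows "{f \<in> space (Pi\<^sub>M I (\<lambda>_. lborel)). (INF y\<in>G. ereal (\<Sum>j\<in>I. f j * y j)) = 0}
    \<in> null_sets (Pi\<^sub>M I (\<lambda>_. lborel))" (is "?A \<in> _")
proof (rule null_sets_PiM_lborel_line[OF I])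
  note [measurable] = borel_measurable_INF_linear[OF I(1), of G]
  show "?A \<in> sets (Pi\<^sub>M I (\<lambda>_. lborel))" by measurable
  have not_less: "\<not> s < t" if fs: "f(i := s) \<in> ?A" and ft: "f(i := t) \<in> ?A" for f s t
  proof
    assume "s < t"
    have upd: "(\<Sum>j\<in>I. (f(i := r)) j * y j) = r + (\<Sum>j\<in>I - {i}. f j * y j)" if "y \<in> G" for r y
      using I G[OF that] by (simp add: sum.remove[of I i])
    have "ereal (t - s) \<le> (INF y\<in>G. ereal (\<Sum>j\<in>I. (f(i := t)) j * y j))"
    proof (rule INF_greatest)
      fix y assume y: "y \<in> G"
      have "0 \<le> (\<Sum>j\<in>I. (f(i := s)) j * y j)"
        using INF_lower[OF y, of "\<lambda>y. ereal (\<Sum>j\<in>I. (f(i := s)) j * y j)"] fs by simp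
      then have "t - s \<le> (\<Sum>j\<in>I. (f(i := t)) j * y j)"
        unfolding upd[OF y] by linarith
      then show "ereal (t - s) \<le> ereal (\<Sum>j\<in>I. (f(i := t)) j * y j)" by simp
    qed
    with ft \<open>s < t\<close> show False by simp
  qed
  then show "s = t" if "f(i := s) \<in> ?A" "f(i := t) \<in> ?A" for f s t
    using that by (meson linorder_cases)
qed

text \<open>Minimizers of a linear functional are monotone in the functional: raising the \<open>i\<close>-th
  coefficient cannot raise the \<open>i\<close>-th coordinate of a minimizer. So each line in direction \<open>i\<close>
  meets \<open>A\<close> at most once.\<close>
lemma null_sets_spread_minimizers:
  fixes p q :: real
  assumes I: "finite I" "i \<in> I" and A: "A \<in> sets (Pi\<^sub>M I (\<lambda>_. lborel))" and pq: "p < q"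
    and lo: "\<And>f. f \<in> A \<Longrightarrow> \<exists>y\<in>F. y i \<le> p \<and> (\<forall>z\<in>F. (\<Sum>j\<in>I. f j * y j) \<le> (\<Sum>j\<in>I. f j * z j))"
    and hi: "\<And>f. f \<in> A \<Longrightarrow> \<exists>y\<in>F. q \<le> y i \<and> (\<forall>z\<in>F. (\<Sum>j\<in>I. f j * y j) \<le> (\<Sum>j\<in>I. f j * z j))"
  shows "A \<in> null_sets (Pi\<^sub>M I (\<lambda>_. lborel))"
proof (rule null_sets_PiM_lborel_line[OF I A])
  have not_less: "\<not> s < t" if fs: "f(i := s) \<in> A" and ft: "f(i := t) \<in> A" for f s t
  proof
    assume "s < t"
    obtain y where y: "y \<in> F" "y i \<le> p"
      "\<And>z. z \<in> F \<Longrightarrow> (\<Sum>j\<in>I. (f(i := s)) j * y j) \<le> (\<Sum>j\<in>I. (f(i := s)) j * z j)"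
      using lo[OF fs] by blast
    obtain u where u: "u \<in> F" "q \<le> u i"
      "\<And>z. z \<in> F \<Longrightarrow> (\<Sum>j\<in>I. (f(i := t)) j * u j) \<le> (\<Sum>j\<in>I. (f(i := t)) j * z j)"
      using hi[OF ft] by blast
    have upd: "(\<Sum>j\<in>I. (f(i := r)) j * z j) = r * z i + (\<Sum>j\<in>I - {i}. f j * z j)" for r z
      using I by (simp add: sum.remove[of I i])
    \<comment> \<open>Sum of the two optimality inequalities; the terms of the other coordinates
      cancel.\<close>
    have "(t - s) * (u i - y i) \<le> 0"
      using y(3)[OF u(1)] u(3)[OF y(1)] unfolding upd by (simp add: algebra_simps)
    moreover have "0 < (t - s) * (u i - y i)" using \<open>s < t\<close> y(2) u(2) pq by simp
    ultimately show False by simp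
  qed
  then show "s = t" if "f(i := s) \<in> A" "f(i := t) \<in> A" for f s t
    using that by (meson linorder_cases)
qed

text \<open>The exceptional polynomials are those with coefficient vector in \<open>Z\<close>; their
  image is a subset of \<open>Z\<close>, hence null in the completion.\<close>

lemma generic_sosI:
  assumes Z: "Z \<in> null_sets (Pi\<^sub>M (exponents_le d) (\<lambda>_. lborel))"
    and P: "\<And>R. R \<in> sos_polys_le d \<Longrightarrow> restrict (Poly_Mapping.lookup R) (exponents_le d) \<notin> Z \<Longrightarrow> P R"
  shows "generic_sos d P"
proof -
  let ?c = "\<lambda>p. restrict (Poly_Mapping.lookup p) (exponents_le d)"
  define N where "N = {R \<in> polys_le d. ?c R \<in> Z}"
  have "?c ` N \<in> null_sets (completion (Pi\<^sub>M (exponents_le d) (\<lambda>_. lborel)))"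
    by (rule null_sets_completion_subset[OF _ null_sets_completionI[OF Z]]) (auto simp: N_def)
  then have "poly_null_set d N" by (auto simp: poly_null_set_def N_def)
  moreover have "\<forall>R\<in>sos_polys_le d - N. P R"
    using P by (auto simp: N_def sos_polys_le_def)
  ultimately show ?thesis unfolding generic_sos_def by blast
qed

lemma uniform_lower_bound_of_pos_INF:
  fixes g :: "'a \<Rightarrow> real"
  assumes "0 < (INF y\<in>G. ereal (g y))"
  shows "\<exists>\<delta>>0. \<forall>y\<in>G. \<delta> \<le> g y"
proof -
  obtain \<delta> where \<delta>: "0 < ereal \<delta>" "ereal \<delta> < (INF y\<in>G. ereal (g y))"
    using ereal_dense2[OF assms] by blast
  have "\<delta> \<le> g y" if "y \<in> G" for y
    using less_le_trans[OF \<delta>(2) INF_lower[OF that]] by simp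
  with \<delta>(1) show ?thesis by auto
qed

text \<open>Ties are expressed by infima rather than minimizers because infima are measurable in
  \<open>f\<close>. Positivity on \<open>K\<close> gives attainment on closed half-spaces, so a tie
  yields minimizers on both sides of the strip.\<close>

lemma null_sets_tied_infima:
  fixes K :: "(real ^ 'n) set" and d :: nat
  defines "I \<equiv> exponents_le d :: (nat ^ 'n) set"
  defines "V \<equiv> \<lambda>G f. INF y\<in>G. ereal (\<Sum>\<alpha>\<in>I. f \<alpha> * y \<alpha>)"
  assumes K: "compact K" and ne: "primal_feasible d K a b \<noteq> {}" and \<alpha>: "\<alpha> \<in> I" and pq: "p < q"
  shows "{f \<in> space (Pi\<^sub>M I (\<lambda>_. lborel)).
      V (primal_feasible d K a b \<inter> {y. y \<alpha> \<le> p}) f = V (primal_feasible d K a b) f \<and>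
      V (primal_feasible d K a b \<inter> {y. q \<le> y \<alpha>}) f = V (primal_feasible d K a b) f \<and>
      0 < V ((\<lambda>x \<alpha>. monom_eval \<alpha> x) ` K) f} \<in> null_sets (Pi\<^sub>M I (\<lambda>_. lborel))"
    (is "?A \<in> _")
proof -
  let ?F = "primal_feasible d K a b"
  have I: "finite I" by (simp add: I_def finite_exponents_le)
  have V_meas: "V G \<in> borel_measurable (Pi\<^sub>M I (\<lambda>_. lborel))" for G
    unfolding V_def by (rule borel_measurable_INF_linear[OF I])
  have hit: "\<exists>y\<in>?F. y \<in> H \<and> (\<forall>z\<in>?F. (\<Sum>j\<in>I. f j * y j) \<le> (\<Sum>j\<in>I. f j * z j))"
    if H: "closed H" and eq: "V (?F \<inter> H) f = V ?F f" and pos: "0 < V ((\<lambda>x \<alpha>. monom_eval \<alpha> x) ` K) f"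
    for H f
  proof -
    obtain \<delta> where \<delta>: "0 < \<delta>" "\<And>x. x \<in> K \<Longrightarrow> \<delta> \<le> (\<Sum>\<alpha>\<in>I. f \<alpha> * monom_eval \<alpha> x)"
      using uniform_lower_bound_of_pos_INF[OF pos[unfolded V_def]] by auto
    obtain y0 where "y0 \<in> ?F" using ne by blast
    then have "V ?F f \<le> ereal (\<Sum>j\<in>I. f j * y0 j)" unfolding V_def by (rule INF_lower)
    \<comment> \<open>An empty intersection would have infimum infinity, which the tie
      excludes.\<close>
    then have "V ?F f \<noteq> \<infinity>" by auto
    then have "?F \<inter> H \<noteq> {}" using eq by (auto simp: V_def top_ereal_def)
    from primal_feasible_attains_min[OF K \<delta>[unfolded I_def] H this]
    obtain y where y: "y \<in> ?F \<inter> H"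
      "\<And>z. z \<in> ?F \<inter> H \<Longrightarrow> (\<Sum>j\<in>I. f j * y j) \<le> (\<Sum>j\<in>I. f j * z j)" unfolding I_def by blast
    have "ereal (\<Sum>j\<in>I. f j * y j) \<le> V (?F \<inter> H) f"
      unfolding V_def using y(2) by (intro INF_greatest) simp
    then have le: "ereal (\<Sum>j\<in>I. f j * y j) \<le> V ?F f" by (simp add: eq)
    have "(\<Sum>j\<in>I. f j * y j) \<le> (\<Sum>j\<in>I. f j * z j)" if "z \<in> ?F" for z
      using order_trans[OF le[unfolded V_def] INF_lower[OF that]] by simp
    with y(1) show ?thesis by blast
  qed
  have cl: "closed {y :: nat ^ 'n \<Rightarrow> real. y \<alpha> \<le> p}" "closed {y :: nat ^ 'n \<Rightarrow> real. q \<le> y \<alpha>}"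
    by (intro closed_Collect_le continuous_intros continuous_on_product_coordinates)+
  show ?thesis
  proof (rule null_sets_spread_minimizers[OF I \<alpha> _ pq, where F = ?F])
    show "?A \<in> sets (Pi\<^sub>M I (\<lambda>_. lborel))"
      \<comment> \<open>Equality of infima is split into two inequalities between measurable
        functions.\<close>
      unfolding order_eq_iff[where 'a = ereal]
      by (intro sets.sets_Collect_conj borel_measurable_le borel_measurable_less
          borel_measurable_const V_meas)
  qed (use hit[OF cl(1)] hit[OF cl(2)] in auto)
qed

theorem proposition3p1:
  fixes d d1 :: nat
    and a :: "'m::finite \<Rightarrow> 'n::finite rpoly" and b :: "real ^ 'm"
    and E I :: "'l set" and c :: "'l \<Rightarrow> 'n rpoly" and K :: "(real ^ 'n) set"
  assumes "d \<ge> 1"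
    and "\<And>i. a i \<in> polys_le d"
    and "d1 = 2 * nat \<lceil>real d / 2\<rceil>"
    and "finite E" and "finite I" and "E \<inter> I = {}"
    and "K = semialgebraic_set E I c"
    and "compact K"
    and "primal_feasible d1 K a b \<noteq> {}"
  shows "generic_sos d1 (\<lambda>R.
           primal_value d1 K a b R = dual_value d1 K a b R \<and>
           (\<exists>y \<in> primal_feasible d1 K a b. ereal (pairing d1 R y) = primal_value d1 K a b R)) \<and>
         generic_sos d1 (\<lambda>R.
           \<exists>ystar. (\<forall>y. primal_minimizer d1 K a b R y \<longleftrightarrow> y = ystar) \<and>
             (\<exists>\<mu> r. representing_measure d1 K ystar \<mu> \<and> atomic_measure r \<mu> \<and> r \<le> CARD('m)))"
proof -
  note K = \<open>compact K\<close> and ne = \<open>primal_feasible d1 K a b \<noteq> {}\<close>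
  have "d \<le> d1" unfolding assms(3) by linarith
  then have "exponents_le d \<subseteq> (exponents_le d1 :: (nat ^ 'n) set)" by (auto simp: exponents_le_def)
  then have a: "a i \<in> polys_le d1" for i using assms(2)[of i] by (auto simp: polys_le_def)
  define J :: "(nat ^ 'n) set" where "J = exponents_le d1"
  define V where "V G f = (INF y\<in>G. ereal (\<Sum>\<alpha>\<in>J. f \<alpha> * y \<alpha>))" for G f
  define M where "M = Pi\<^sub>M J (\<lambda>_. lborel :: real measure)"
  define X where "X = (\<lambda>x \<alpha>. monom_eval \<alpha> x) ` K"
  define F where "F = primal_feasible d1 K a b"
  define co where "co R = restrict (Poly_Mapping.lookup R) J" for R :: "'n rpoly"
  have J: "finite J" "0 \<in> J" by (simp_all add: J_def finite_exponents_le zero_in_exponents_le)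
  have V_co: "V G (co R) = (INF y\<in>G. ereal (pairing d1 R y))" for G R
    by (simp add: V_def co_def pairing_def J_def)
  \<comment> \<open>Outside \<open>Z\<close> a sum of squares has a positive lower bound on
    \<open>K\<close>. For empty \<open>K\<close> the infimum is infinity and \<open>Z\<close> is
    empty.\<close>
  define Z where "Z = {f \<in> space M. V X f = 0}"
  have Z: "Z \<in> null_sets M"
    unfolding Z_def M_def V_def by (rule null_sets_infimum_zero[OF J]) (auto simp: X_def)
  have pos: "0 < V X (co R)" if R: "R \<in> sos_polys_le d1" "co R \<notin> Z" for R
  proof -
    have "V X (co R) = (INF x\<in>K. ereal (poly_eval R x))"
      using R(1) by (simp add: V_co X_def image_image pairing_def poly_eval_polys_le[of R d1] sos_polys_le_def)
    also have "\<dots> \<ge> 0"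
      using R(1) by (intro INF_greatest) (simp add: sos_polys_le_def poly_eval_sos_nonneg)
    finally have "0 \<le> V X (co R)" .
    moreover have "V X (co R) \<noteq> 0"
      using R(2) by (simp add: Z_def M_def space_PiM co_def)
    ultimately show ?thesis by simp
  qed
  have strict: "\<exists>\<delta>>0. \<forall>x\<in>K. \<delta> \<le> poly_eval R x" if R: "R \<in> sos_polys_le d1" "co R \<notin> Z" for R
  proof -
    have "0 < (INF y\<in>X. ereal (pairing d1 R y))" using pos[OF R] by (simp add: V_co)
    then have "\<exists>\<delta>>0. \<forall>y\<in>X. \<delta> \<le> pairing d1 R y"
      by (rule uniform_lower_bound_of_pos_INF)
    then show ?thesis
      using R(1) by (auto simp: X_def pairing_def poly_eval_polys_le[of R d1] sos_polys_le_def)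
  qed
  define B where "B \<alpha> p q = {f \<in> space M. V (F \<inter> {y. y \<alpha> \<le> p}) f = V F f \<and>
    V (F \<inter> {y. q \<le> y \<alpha>}) f = V F f \<and> 0 < V X f}" for \<alpha> p q
  \<comment> \<open>Rational end points keep the union of exceptional sets countable.\<close>
  define T where "T = {(\<alpha>, p, q). \<alpha> \<in> J \<and> p \<in> \<rat> \<and> q \<in> \<rat> \<and> p < (q :: real)}"
  define W where "W = Z \<union> (\<Union>(\<alpha>, p, q)\<in>T. B \<alpha> p q)"
  have "countable (J \<times> (\<rat> :: real set) \<times> (\<rat> :: real set))"
    by (intro countable_SIGMA countable_finite[OF J(1)] countable_rat)
  then have "countable T" by (rule countable_subset[rotated]) (auto simp: T_def)
  moreover have "B \<alpha> p q \<in> null_sets M" if "(\<alpha>, p, q) \<in> T" for \<alpha> p q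
    using null_sets_tied_infima[OF K ne, of \<alpha> p q] that
    by (simp add: T_def B_def M_def V_def F_def X_def J_def)
  ultimately have "(\<Union>t\<in>T. case t of (\<alpha>, p, q) \<Rightarrow> B \<alpha> p q) \<in> null_sets M"
    by (intro null_sets_UN') auto
  with Z have W: "W \<in> null_sets M" unfolding W_def by (rule null_sets.Un)
  show ?thesis
  proof
    show "generic_sos d1 (\<lambda>R. primal_value d1 K a b R = dual_value d1 K a b R \<and>
        (\<exists>y \<in> primal_feasible d1 K a b. ereal (pairing d1 R y) = primal_value d1 K a b R))"
    proof (rule generic_sosI[OF Z[unfolded M_def J_def]])
      fix R :: "'n rpoly"
      assume R: "R \<in> sos_polys_le d1" "restrict (Poly_Mapping.lookup R) (exponents_le d1) \<notin> Z"
      then obtain \<delta> where "0 < \<delta>" "\<And>x. x \<in> K \<Longrightarrow> \<delta> \<le> poly_eval R x"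
        using strict[of R] by (auto simp: co_def J_def)
      moreover have "R \<in> polys_le d1" using R(1) by (simp add: sos_polys_le_def)
      ultimately show "primal_value d1 K a b R = dual_value d1 K a b R \<and>
        (\<exists>y \<in> primal_feasible d1 K a b. ereal (pairing d1 R y) = primal_value d1 K a b R)"
        using strong_duality[OF K a _ _ _ ne] by blast
    qed
  next
    show "generic_sos d1 (\<lambda>R.
           \<exists>ystar. (\<forall>y. primal_minimizer d1 K a b R y \<longleftrightarrow> y = ystar) \<and>
             (\<exists>\<mu> r. representing_measure d1 K ystar \<mu> \<and> atomic_measure r \<mu> \<and> r \<le> CARD('m)))"
    proof (rule generic_sosI[OF W[unfolded M_def J_def]])
      fix R :: "'n rpoly"
      assume "R \<in> sos_polys_le d1" "restrict (Poly_Mapping.lookup R) (exponents_le d1) \<notin> W"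
      then have R: "R \<in> sos_polys_le d1" "co R \<notin> Z" and notB: "\<And>\<alpha> p q. (\<alpha>, p, q) \<in> T \<Longrightarrow> co R \<notin> B \<alpha> p q"
        unfolding W_def co_def J_def by auto
      have Rd: "R \<in> polys_le d1" using R(1) by (simp add: sos_polys_le_def)
      obtain \<delta> where \<delta>: "0 < \<delta>" "\<And>x. x \<in> K \<Longrightarrow> \<delta> \<le> poly_eval R x" using strict[OF R] by blast
      have minimizer_iff: "primal_minimizer d1 K a b R y \<longleftrightarrow>
          y \<in> F \<and> (\<forall>z\<in>F. pairing d1 R y \<le> pairing d1 R z)" for y
        by (auto simp: primal_minimizer_def is_arg_min_def F_def not_less)
      obtain y where y: "y \<in> F" "ereal (pairing d1 R y) = primal_value d1 K a b R"
        using strong_duality(2)[OF K a Rd \<delta> ne] by (auto simp: F_def)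
      have ymin: "pairing d1 R y \<le> pairing d1 R z" if "z \<in> F" for z
      proof -
        have "ereal (pairing d1 R y) \<le> ereal (pairing d1 R z)"
          unfolding y(2) primal_value_def using that by (intro INF_lower) (simp add: F_def)
        then show ?thesis by simp
      qed
      \<comment> \<open>A minimizer lying in \<open>H\<close> makes the infimum over
        \<open>F \<inter> H\<close> the overall minimum; the whole space and the two half-spaces are
        the cases used.\<close>
      have V_min: "V (F \<inter> H) (co R) = ereal (pairing d1 R u)"
        if u: "u \<in> F \<inter> H" "\<forall>z\<in>F. pairing d1 R u \<le> pairing d1 R z" for u H
        unfolding V_co by (rule antisym) (use u in \<open>auto intro: INF_lower INF_greatest\<close>)
      have not_lt: "\<not> u \<alpha> < u' \<alpha>" if u: "u \<in> F" "\<forall>z\<in>F. pairing d1 R u \<le> pairing d1 R z"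
        and u': "u' \<in> F" "\<forall>z\<in>F. pairing d1 R u' \<le> pairing d1 R z" and \<alpha>: "\<alpha> \<in> J" for u u' \<alpha>
      proof
        assume "u \<alpha> < u' \<alpha>"
        \<comment> \<open>Two rationals between the coordinates give a strip that separates the
          minimizers \<open>u\<close> and \<open>u'\<close>, which puts \<open>R\<close> in an
          excluded set.\<close>
        then obtain p where p: "p \<in> \<rat>" "u \<alpha> < p" "p < u' \<alpha>" using Rats_dense_in_real by blast
        then obtain q where q: "q \<in> \<rat>" "p < q" "q < u' \<alpha>" using Rats_dense_in_real by blast
        have "pairing d1 R u = pairing d1 R u'" using u u' by (intro antisym) auto
        then have "co R \<in> B \<alpha> p q"
          using V_min[of u UNIV] V_min[of u "{y. y \<alpha> \<le> p}"] V_min[of u' "{y. q \<le> y \<alpha>}"] u u' p q pos[OF R]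
          by (simp add: B_def M_def space_PiM co_def)
        with notB[of \<alpha> p q] \<alpha> p q show False by (simp add: T_def)
      qed
      have uniq: "z = y" if z: "z \<in> F" "pairing d1 R z = pairing d1 R y" for z
      proof (rule extensionalityI[of _ J])
        show "z \<in> extensional J" "y \<in> extensional J"
          using z(1) y(1) by (auto simp: F_def primal_feasible_def moment_cone_def tms_def J_def)
        show "z \<alpha> = y \<alpha>" if "\<alpha> \<in> J" for \<alpha>
          using not_lt[of z y \<alpha>] not_lt[of y z \<alpha>] z y(1) ymin that by fastforce
      qed
      obtain S w where S: "finite S" "S \<subseteq> K" "\<forall>x\<in>S. 0 < w x"
        "y = (\<lambda>\<alpha>\<in>exponents_le d1. \<Sum>x\<in>S. w x * monom_eval \<alpha> x)" "card S \<le> CARD('m)"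
        using unique_minimizer_few_atoms[OF K a Rd y(1)[unfolded F_def], folded F_def, OF ymin uniq]
        by blast
      have "\<exists>\<mu> r. representing_measure d1 K y \<mu> \<and> atomic_measure r \<mu> \<and> r \<le> CARD('m)"
        using representing_measure_atoms[OF S(1-3), of d1] S(5) unfolding S(4) by blast
      moreover have "\<forall>z. primal_minimizer d1 K a b R z \<longleftrightarrow> z = y"
        unfolding minimizer_iff using y(1) ymin uniq by (auto intro: antisym)
      ultimately show "\<exists>ystar. (\<forall>y. primal_minimizer d1 K a b R y \<longleftrightarrow> y = ystar) \<and>
             (\<exists>\<mu> r. representing_measure d1 K ystar \<mu> \<and> atomic_measure r \<mu> \<and> r \<le> CARD('m))"
        by blast
    qed
  qed
qed

end
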